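(* Let $X$ be a squared $\kappa$-$\mu$ shadowed random variable with mean $\bar\gamma>0$ and shape parameters $\kappa,\mu,m$, and let $\hat X$ be a squared $\kappa$-$\mu$ shadowed random variable with mean $\widetilde\gamma>0$ and shape parameters $\hat\kappa,\hat\mu,\hat m$, where $\kappa,\hat\kappa$ are arbitrary non-negative real numbers and $\mu,m,\hat\mu,\hat m$ are positive integers. Assume $X$ and $\hat X$ are independent (not necessarily identically distributed). Let $M,(C_j,m_j,\Omega_j)_{0\le j\le M}$ be the mixture parameters associated with $(\bar\gamma,\kappa,\mu,m)$, and $\hat M,(\hat C_h,\hat m_h,\hat\Omega_h)_{0\le h\le\hat M}$ those associated with $(\widetilde\gamma,\hat\kappa,\hat\mu,\hat m)$. Then $Z=X\hat X$ has moment-generating function $\mathcal{M}_Z(s)=E[e^{sZ}]$ given by $$\mathcal{M}_Z(s)=\sum_{j=0}^{M}\sum_{h=0}^{\hat M} C_j\hat C_h\,\frac{e^{-\frac{1}{2s\Omega_j\hat\Omega_h}}}{\left(-s\,\Omega_j\hat\Omega_h\right)^{\frac{m_j+\hat m_h-1}{2}}}\;\mathcal{W}_{-\frac{m_j+\hat m_h-1}{2},\,\frac{m_j-\hat m_h}{2}}\!\left(-\frac{1}{s\,\Omega_j\hat\Omega_h}\right),$$ where $\mathcal{W}_{a,b}$ is the Whittaker function, which can be expressed in terms of the Tricomi hypergeometric function.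
   Context: Squared $\kappa$-$\mu$ shadowed distribution: a positive random variable $\gamma$ is a squared $\kappa$-$\mu$ shadowed random variable with mean $\bar\gamma>0$ and shape parameters $\kappa\ge 0$, $\mu>0$, $m>0$ if it has density, for $x>0$, $$f(x)=\frac{\mu^\mu m^m(1+\kappa)^\mu}{\Gamma(\mu)\,\bar\gamma\,(\mu\kappa+m)^m}\left(\frac{x}{\bar\gamma}\right)^{\mu-1}e^{-\frac{\mu(1+\kappa)x}{\bar\gamma}}\;{}_1F_1\!\left(m;\mu;\frac{\mu^2\kappa(1+\kappa)}{\mu\kappa+m}\frac{x}{\bar\gamma}\right),$$ where ${}_1F_1$ is the Kummer confluent hypergeometric function. Mixture parameters associated with $(\bar\gamma,\kappa,\mu,m)$ ($\mu,m$ positive integers): put $p=\frac{m}{\mu\kappa+m}$, $q=\frac{\mu\kappa}{\mu\kappa+m}$, $\Delta_1=\frac{\bar\gamma}{\mu(1+\kappa)}$, $\Delta_2=\frac{\mu\kappa+m}{m}\cdot\frac{\bar\gamma}{\mu(1+\kappa)}$. Case $\mu>m$: $M=\mu$, and - for $i=0$: $C_0=0$, $m_0=\mu-m+1$, $\Omega_0=\Delta_1$; - for $0<i\le\mu-m$: $C_i=(-1)^m\binom{m+i-2}{i-1}p^{m}q^{-m-i+1}$, $m_i=\mu-m-i+1$, $\Omega_i=\Delta_1$; - for $\mu-m<i\le\mu$: $C_i=(-1)^{i-\mu+m-1}\binom{i-2}{i-\mu+m-1}p^{\,i-\mu+m-1}q^{-i+1}$, $m_i=\mu-i+1$, $\Omega_i=\Delta_2$.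 Case $\mu\le m$: $M=m-\mu$, and for $0\le i\le M$: $C_i=\binom{m-\mu}{i}p^{i}q^{\,m-\mu-i}$ (with $0^0=1$), $m_i=m-i$, $\Omega_i=\Delta_2$. The hatted parameters $\hat M,\hat C_h,\hat m_h,\hat\Omega_h$ are obtained by the same formulas with $(\bar\gamma,\kappa,\mu,m)$ replaced by $(\widetilde\gamma,\hat\kappa,\hat\mu,\hat m)$. Whittaker function: $\mathcal{W}_{a,b}(x)=e^{-x/2}x^{b+1/2}\,U\!\left(b-a+\tfrac12,\,1+2b,\,x\right)$, where $U$ is the Tricomi confluent hypergeometric function.
   Formalization: The formula is proved for real s<0 (for s>0 the MGF is infinite; at s=0 the formula is undefined). If κ=0 with μ>m (or the hatted analogue), C_i has negative powers of q=0 and is undefined; there the identity is proved as a limit in κ, κ̂. *)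

theory Defs
  imports "HOL-Probability.Probability"
begin

definition kummer_1F1 :: "real \<Rightarrow> real \<Rightarrow> real \<Rightarrow> real" where
  "kummer_1F1 a b z = (\<Sum>n. pochhammer a n / pochhammer b n * z ^ n / fact n)"

(* Tricomi's function U(a,b,x) for real a, b and x > 0: the value at x of the solution of
   Kummer's equation t u'' + (b - t) u' - a u = 0 on the positive half-line with u(t) ~ t^(-a)
   as t tends to infinity.  This solution is unique, since every solution linearly independent
   of it grows like e^t t^(a-b); unlike an expression through two 1F1's it needs no separate
   treatment of integer b. *)
definition kummer_recessive :: "real \<Rightarrow> real \<Rightarrow> (real \<Rightarrow> real) \<Rightarrow> bool" where
  "kummer_recessive a b u \<longleftrightarrow>
     (\<exists>u' u''. \<forall>t>0. (u has_real_derivative u' t) (at t) \<and>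
                     (u' has_real_derivative u'' t) (at t) \<and>
                     t * u'' t + (b - t) * u' t - a * u t = 0) \<and>
     ((\<lambda>t. t powr a * u t) \<longlongrightarrow> 1) at_top"

definition tricomi_U :: "real \<Rightarrow> real \<Rightarrow> real \<Rightarrow> real" where
  "tricomi_U a b x = (THE y. \<exists>u. kummer_recessive a b u \<and> u x = y)"

definition whittaker_W :: "real \<Rightarrow> real \<Rightarrow> real \<Rightarrow> real" where
  "whittaker_W a b x = exp (- x / 2) * x powr (b + 1/2) * tricomi_U (b - a + 1/2) (1 + 2 * b) x"

definition kms_density :: "real \<Rightarrow> real \<Rightarrow> real \<Rightarrow> real \<Rightarrow> real \<Rightarrow> real" where
  "kms_density \<gamma> \<kappa> \<mu> m x = (if x > 0 then
     \<mu> powr \<mu> * m powr m * (1 + \<kappa>) powr \<mu> / (Gamma \<mu> * \<gamma> * (\<mu> * \<kappa> + m) powr m)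
     * (x / \<gamma>) powr (\<mu> - 1) * exp (- (\<mu> * (1 + \<kappa>) * x / \<gamma>))
     * kummer_1F1 m \<mu> (\<mu>\<^sup>2 * \<kappa> * (1 + \<kappa>) / (\<mu> * \<kappa> + m) * (x / \<gamma>))
   else 0)"

definition squared_kappa_mu_shadowed ::
  "'a measure \<Rightarrow> ('a \<Rightarrow> real) \<Rightarrow> real \<Rightarrow> real \<Rightarrow> real \<Rightarrow> real \<Rightarrow> bool" where
  "squared_kappa_mu_shadowed P X \<gamma> \<kappa> \<mu> m \<longleftrightarrow>
     \<gamma> > 0 \<and> \<kappa> \<ge> 0 \<and> \<mu> > 0 \<and> m > 0 \<and>
     distributed P lborel X (\<lambda>x. ennreal (kms_density \<gamma> \<kappa> \<mu> m x))"

definition mgf :: "'a measure \<Rightarrow> ('a \<Rightarrow> real) \<Rightarrow> real \<Rightarrow> real" where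
  "mgf P Z s = (\<integral>\<omega>. exp (s * Z \<omega>) \<partial>P)"

definition mix_p :: "real \<Rightarrow> nat \<Rightarrow> nat \<Rightarrow> real" where
  "mix_p \<kappa> \<mu> m = real m / (real \<mu> * \<kappa> + real m)"

definition mix_q :: "real \<Rightarrow> nat \<Rightarrow> nat \<Rightarrow> real" where
  "mix_q \<kappa> \<mu> m = real \<mu> * \<kappa> / (real \<mu> * \<kappa> + real m)"

definition mix_\<Delta>1 :: "real \<Rightarrow> real \<Rightarrow> nat \<Rightarrow> real" where
  "mix_\<Delta>1 \<gamma> \<kappa> \<mu> = \<gamma> / (real \<mu> * (1 + \<kappa>))"

definition mix_\<Delta>2 :: "real \<Rightarrow> real \<Rightarrow> nat \<Rightarrow> nat \<Rightarrow> real" where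
  "mix_\<Delta>2 \<gamma> \<kappa> \<mu> m = (real \<mu> * \<kappa> + real m) / real m * (\<gamma> / (real \<mu> * (1 + \<kappa>)))"

definition mix_M :: "nat \<Rightarrow> nat \<Rightarrow> nat" where
  "mix_M \<mu> m = (if m < \<mu> then \<mu> else m - \<mu>)"

(* Natural-number subtractions below are exact for \<mu>, m \<ge> 1 and i \<le> mix_M \<mu> m.
   For m < \<mu> and \<kappa> = 0 the coefficients are undefined (negative powers of mix_q = 0);
   the totalised value 0 returned here then has no meaning. *)
definition mix_C :: "real \<Rightarrow> nat \<Rightarrow> nat \<Rightarrow> nat \<Rightarrow> real" where
  "mix_C \<kappa> \<mu> m i =
     (if m < \<mu> then
        (if i = 0 then 0
         else if i \<le> \<mu> - m then
           (-1) ^ m * real ((m + i - 2) choose (i - 1))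
           * mix_p \<kappa> \<mu> m ^ m * mix_q \<kappa> \<mu> m powi (- int m - int i + 1)
         else
           (-1) ^ (i + m - \<mu> - 1) * real ((i - 2) choose (i + m - \<mu> - 1))
           * mix_p \<kappa> \<mu> m ^ (i + m - \<mu> - 1) * mix_q \<kappa> \<mu> m powi (- int i + 1))
      else real ((m - \<mu>) choose i) * mix_p \<kappa> \<mu> m ^ i * mix_q \<kappa> \<mu> m ^ (m - \<mu> - i))"

definition mix_m :: "nat \<Rightarrow> nat \<Rightarrow> nat \<Rightarrow> nat" where
  "mix_m \<mu> m i =
     (if m < \<mu> then
        (if i = 0 then \<mu> - m + 1
         else if i \<le> \<mu> - m then \<mu> - m - i + 1
         else \<mu> - i + 1)
      else m - i)"

definition mix_\<Omega> :: "real \<Rightarrow> real \<Rightarrow> nat \<Rightarrow> nat \<Rightarrow> nat \<Rightarrow> real" where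
  "mix_\<Omega> \<gamma> \<kappa> \<mu> m i =
     (if m < \<mu> \<and> i \<le> \<mu> - m then mix_\<Delta>1 \<gamma> \<kappa> \<mu> else mix_\<Delta>2 \<gamma> \<kappa> \<mu> m)"

end

theory Submission
  imports Defs "HOL-Real_Asymp.Real_Asymp"
begin

text \<open>For \<open>s < 0\<close> the expectation of \<open>exp (s X X')\<close> is the integral of the density of \<open>X'\<close> against the
  Laplace transform \<open>L\<close> of \<open>X\<close> at \<open>- s y\<close>. The series of \<open>\<^sub>1F\<^sub>1\<close> makes the density a negative binomial
  mixture of Erlang densities, whence \<open>L(\<lambda>) = (1 + \<Delta>\<^sub>1\<lambda>)\<^bsup>m-\<mu>\<^esup> (1 + \<Delta>\<^sub>2\<lambda>)\<^bsup>-m\<^esup>\<close>; the mixture coefficients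
  are those of its partial fraction expansion into Erlang transforms. As the pairing of densities and
  transforms is symmetric (Tonelli), expanding first \<open>X\<close> and then \<open>X'\<close> reduces the claim to two
  Erlang variables, for which the integral is the Laplace integral of Tricomi's \<open>U\<close>. No uniqueness theorem
  for Laplace transforms is needed, and the coefficients enter only through \<open>L\<close>, so the singular
  case \<open>\<kappa> = 0\<close>, \<open>m < \<mu>\<close> follows by dominated convergence.\<close>

section \<open>Tricomi's function as a Laplace integral\<close>

text \<open>For \<open>m < \<mu>\<close> the mixture coefficients have both signs, so the expansion
  is no probabilistic mixing; only the closed form of the transform is expanded, never the density.
  At \<kappa> = 0 the scales \<Delta>1 and \<Delta>2 coincide: two poles of the transform merge, so
  single coefficients blow up while the transform stays regular. Continuity is therefore proved for
  the integral and only then carried over to the sum. Tricomi's function is fixed by a description,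
  so its values are reached by exhibiting one explicit recessive solution and excluding all others.
  The explicit partial fraction coefficients come from the Chaundy-Bullard identity, a polynomial
  identity under \<open>x + y = 1\<close>.\<close>

text \<open>The Wronskian of two solutions is a multiple of \<open>t\<^bsup>-b\<^esup> e\<^sup>t\<close>. If it were nonzero, the ratio of the
  solutions would have derivative tending to infinity, although it converges to \<open>1\<close>.\<close>

lemma kummer_recessive_eq_on_pos:
  assumes u: "kummer_recessive a b u" and v: "kummer_recessive a b v"
    and pos: "\<And>t. t > 0 \<Longrightarrow> u t > 0" and "x > 0"
  shows "v x = u x"
proof -
  obtain u' u'' where u': "\<And>t. t > 0 \<Longrightarrow> (u has_real_derivative u' t) (at t)"
    and u'': "\<And>t. t > 0 \<Longrightarrow> (u' has_real_derivative u'' t) (at t)"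
    and odeu: "\<And>t. t > 0 \<Longrightarrow> t * u'' t + (b - t) * u' t - a * u t = 0"
    and limu: "((\<lambda>t. t powr a * u t) \<longlongrightarrow> 1) at_top"
    using u unfolding kummer_recessive_def by blast
  obtain v' v'' where v': "\<And>t. t > 0 \<Longrightarrow> (v has_real_derivative v' t) (at t)"
    and v'': "\<And>t. t > 0 \<Longrightarrow> (v' has_real_derivative v'' t) (at t)"
    and odev: "\<And>t. t > 0 \<Longrightarrow> t * v'' t + (b - t) * v' t - a * v t = 0"
    and limv: "((\<lambda>t. t powr a * v t) \<longlongrightarrow> 1) at_top"
    using v unfolding kummer_recessive_def by blast
  define N where "N t = (u t * v' t - u' t * v t) * (t powr b * exp (- t))" for t
  define r where "r t = v t / u t" for t
  have "\<exists>c. \<forall>t\<in>{0<..}. N t = c"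
  proof (rule has_field_derivative_zero_constant)
    show "(N has_real_derivative 0) (at t within {0<..})" if "t \<in> {0<..}" for t
    proof -
      from that have t: "t > 0" by simp
      have "((\<lambda>t. u t * v' t - u' t * v t) has_real_derivative
              (u' t * v' t + v'' t * u t) - (u'' t * v t + v' t * u' t)) (at t)"
        by (intro DERIV_diff DERIV_mult u' u'' v' v'' t)
      moreover have "((\<lambda>t. exp (- t)) has_real_derivative - exp (- t)) (at t)"
        by (auto intro!: derivative_eq_intros)
      then have "((\<lambda>t. t powr b * exp (- t)) has_real_derivative
              b * t powr (b - 1) * exp (- t) + - exp (- t) * t powr b) (at t)"
        by (intro DERIV_mult has_real_derivative_powr t)
      ultimately have "(N has_real_derivative
              ((u' t * v' t + v'' t * u t) - (u'' t * v t + v' t * u' t)) * (t powr b * exp (- t)) +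
              (b * t powr (b - 1) * exp (- t) + - exp (- t) * t powr b) * (u t * v' t - u' t * v t)) (at t)"
        unfolding N_def by (rule DERIV_mult)
      \<comment> \<open>Splitting off \<open>t powr (b - 1)\<close> leaves \<open>u\<close> times
        the equation for \<open>v\<close> minus \<open>v\<close> times the equation for
        \<open>u\<close>.\<close>
      also have "t powr b = t * t powr (b - 1)"
        using t by (simp add: powr_diff)
      also have "((u' t * v' t + v'' t * u t) - (u'' t * v t + v' t * u' t)) * (t * t powr (b - 1) * exp (- t)) +
              (b * t powr (b - 1) * exp (- t) + - exp (- t) * (t * t powr (b - 1))) * (u t * v' t - u' t * v t)
          = t powr (b - 1) * exp (- t) *
            (u t * (t * v'' t + (b - t) * v' t - a * v t) - v t * (t * u'' t + (b - t) * u' t - a * u t))"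
        by algebra
      also have "\<dots> = 0" using odeu[OF t] odev[OF t] by simp
      finally show ?thesis by (rule DERIV_subset) simp
    qed
  qed simp
  then obtain c where c: "\<And>t. t > 0 \<Longrightarrow> N t = c" by auto
  \<comment> \<open>The derivative is written over \<open>(t powr a * u t)\<^sup>2\<close> because
    this denominator tends to 1; the growth is then that of
    \<open>exp t * t powr (2 * a - b)\<close>.\<close>
  have r': "(r has_real_derivative c * exp t * t powr (2 * a - b) / (t powr a * u t)\<^sup>2) (at t)" if t: "t > 0" for t
  proof -
    have "u t \<noteq> 0" using pos[OF t] by simp
    have W: "u t * v' t - u' t * v t = c * exp t * t powr (- b)"
    proof -
      have "t powr b * exp (- t) \<noteq> 0" using t by simp
      then have "u t * v' t - u' t * v t = c / (t powr b * exp (- t))"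
        using c[OF t] unfolding N_def by (metis nonzero_mult_div_cancel_right)
      also have "\<dots> = c * exp t * t powr (- b)"
        by (simp add: powr_minus exp_minus divide_inverse)
      finally show ?thesis .
    qed
    have "(r has_real_derivative (v' t * u t - v t * u' t) / (u t * u t)) (at t)"
      unfolding r_def by (intro DERIV_divide v' u' t \<open>u t \<noteq> 0\<close>)
    also have "(v' t * u t - v t * u' t) / (u t * u t) = (c * exp t * t powr (- b)) / (u t)\<^sup>2"
      using W by (simp add: mult.commute power2_eq_square)
    also have "\<dots> = c * exp t * t powr (2 * a - b) / (t powr a * u t)\<^sup>2"
    proof -
      have "t powr (2 * a - b) = t powr (- b) * (t powr a)\<^sup>2"
        unfolding power2_eq_square powr_add[symmetric] by simp
      then show ?thesis using t \<open>u t \<noteq> 0\<close> by (simp add: power_mult_distrib)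
    qed
    finally show ?thesis .
  qed
  have limr: "(r \<longlongrightarrow> 1) at_top"
  proof -
    have "((\<lambda>t. (t powr a * v t) / (t powr a * u t)) \<longlongrightarrow> 1 / 1) at_top"
      by (intro tendsto_divide limu limv) simp
    then have "((\<lambda>t. (t powr a * v t) / (t powr a * u t)) \<longlongrightarrow> 1) at_top" by simp
    moreover have "\<forall>\<^sub>F t in at_top. (t powr a * v t) / (t powr a * u t) = r t"
      using eventually_gt_at_top[of 0] by eventually_elim (simp add: r_def)
    ultimately show ?thesis by (rule Lim_transform_eventually)
  qed
  have "c = 0"
  proof (rule ccontr)
    assume "c \<noteq> 0"
    have grow: "filterlim (\<lambda>t. exp t * t powr (2 * a - b)) at_top at_top"
      by real_asymp
    have "filterlim (\<lambda>t. inverse ((t powr a * u t)\<^sup>2) * (exp t * t powr (2 * a - b))) at_top at_top"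
    proof (rule filterlim_tendsto_pos_mult_at_top[OF _ _ grow])
      show "((\<lambda>t. inverse ((t powr a * u t)\<^sup>2)) \<longlongrightarrow> inverse (1\<^sup>2)) at_top"
        by (intro tendsto_inverse tendsto_power limu) simp
    qed simp
    then have "\<forall>\<^sub>F t in at_top. inverse ((t powr a * u t)\<^sup>2) * (exp t * t powr (2 * a - b)) \<ge> 1 / \<bar>c\<bar>"
      by (simp add: filterlim_at_top)
    then obtain T where T: "\<And>t. t \<ge> T \<Longrightarrow> inverse ((t powr a * u t)\<^sup>2) * (exp t * t powr (2 * a - b)) \<ge> 1 / \<bar>c\<bar>"
      by (auto simp: eventually_at_top_linorder)
    \<comment> \<open>The threshold \<open>1 / \<bar>c\<bar>\<close> makes the derivative of
      \<open>r\<close> at least 1 in absolute value beyond \<open>T\<close>. By the mean value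
      theorem the increments over unit intervals are then at least 1, while convergence of
      \<open>r\<close> forces them to 0.\<close>
    have big: "\<bar>r (t + 1) - r t\<bar> \<ge> 1" if t: "t \<ge> max T 1" for t
    proof -
      define R where "R w = c * exp w * w powr (2 * a - b) / (w powr a * u w)\<^sup>2" for w
      have "\<exists>z>t. z < t + 1 \<and> r (t + 1) - r t = (t + 1 - t) * R z"
      proof (rule MVT2)
        fix w assume "t \<le> w"
        then have "w > 0" using t by simp
        from r'[OF this] show "(r has_real_derivative R w) (at w)" by (simp only: R_def)
      qed simp
      then obtain z where z: "t < z" "z < t + 1"
        and rz: "r (t + 1) - r t = R z" by auto
      have "\<bar>r (t + 1) - r t\<bar> = \<bar>c\<bar> * (inverse ((z powr a * u z)\<^sup>2) * (exp z * z powr (2 * a - b)))"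
        unfolding rz R_def by (simp add: abs_mult divide_inverse mult_ac)
      also have "\<dots> \<ge> \<bar>c\<bar> * (1 / \<bar>c\<bar>)"
        using T[of z] z t by (intro mult_left_mono) auto
      finally show ?thesis using \<open>c \<noteq> 0\<close> by simp
    qed
    have "filterlim (\<lambda>t::real. t + 1) at_top at_top" by real_asymp
    then have "((\<lambda>t. r (t + 1)) \<longlongrightarrow> 1) at_top"
      by (rule filterlim_compose[OF limr])
    then have "((\<lambda>t. \<bar>r (t + 1) - r t\<bar>) \<longlongrightarrow> \<bar>1 - 1\<bar>) at_top"
      by (intro tendsto_intros limr)
    then have "1 \<le> \<bar>1 - 1 :: real\<bar>"
      by (rule tendsto_lowerbound)
         (use big in \<open>auto simp: eventually_at_top_linorder intro!: exI[of _ "max T 1"]\<close>)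
    then show False by simp
  qed
  have "\<exists>d. \<forall>t\<in>{0<..}. r t = d"
  proof (rule has_field_derivative_zero_constant)
    show "(r has_real_derivative 0) (at t within {0<..})" if "t \<in> {0<..}" for t
      using r'[of t] that \<open>c = 0\<close> by (auto intro: DERIV_subset)
  qed simp
  then obtain d where d: "\<And>t. t > 0 \<Longrightarrow> r t = d" by auto
  have "((\<lambda>_. d) \<longlongrightarrow> 1) (at_top :: real filter)"
    by (rule Lim_transform_eventually[OF limr])
       (use eventually_gt_at_top[of "0::real"] in eventually_elim, simp add: d)
  then have "d = 1" by (simp add: tendsto_const_iff)
  then show ?thesis
    using d[OF \<open>x > 0\<close>] pos[OF \<open>x > 0\<close>] by (simp add: r_def)
qed

text \<open>Positivity of the known solution allows dividing by it on the whole half-line; the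
  competing solution may have any sign.\<close>

lemma tricomi_U_eqI:
  assumes "kummer_recessive a b u" and "\<And>t. t > 0 \<Longrightarrow> u t > 0" and "x > 0"
  shows "tricomi_U a b x = u x"
  unfolding tricomi_U_def
proof (rule the_equality)
  show "\<exists>v. kummer_recessive a b v \<and> v x = u x" using assms(1) by blast
next
  fix y assume "\<exists>v. kummer_recessive a b v \<and> v x = y"
  then obtain v where v: "kummer_recessive a b v" and "v x = y" by blast
  then show "y = u x" using kummer_recessive_eq_on_pos[OF assms(1) v assms(2,3)] by simp
qed

text \<open>Dominated convergence for difference quotients along sequences. By the mean value
  theorem, the quotients of \<open>exp (- y * t)\<close> between points above \<open>x / 2\<close>
  are at most \<open>t * exp (- (x / 2) * t)\<close>, whence integrability is assumed at every
  positive point and not only at \<open>x\<close>.\<close>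

lemma has_real_derivative_laplace:
  fixes \<phi> :: "real \<Rightarrow> real"
  assumes [measurable]: "\<phi> \<in> borel_measurable borel"
    and supp: "\<And>t. t < 0 \<Longrightarrow> \<phi> t = 0"
    and int0: "\<And>x. x > 0 \<Longrightarrow> integrable lborel (\<lambda>t. \<phi> t * exp (- x * t))"
    and int1: "\<And>x. x > 0 \<Longrightarrow> integrable lborel (\<lambda>t. t * \<phi> t * exp (- x * t))"
    and "x > 0"
  shows "((\<lambda>x. \<integral>t. \<phi> t * exp (- x * t) \<partial>lborel) has_real_derivative
            - (\<integral>t. t * \<phi> t * exp (- x * t) \<partial>lborel)) (at x)"
  unfolding has_field_derivative_iff tendsto_at_iff_sequentially comp_def
proof (intro allI impI)
  fix X :: "nat \<Rightarrow> real"
  assume "\<forall>i. X i \<in> UNIV - {x}" and X: "X \<longlonglongrightarrow> x"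
  then have ne: "X i \<noteq> x" for i by auto
  have ev: "\<forall>\<^sub>F i in sequentially. X i > x / 2"
    using order_tendstoD(1)[OF X, of "x / 2"] \<open>x > 0\<close> by simp
  \<comment> \<open>Shifting the sequence by \<open>N\<close> makes the bound hold for every index,
    as dominated convergence asks.\<close>
  then obtain N where N: "\<And>i. X (i + N) > x / 2"
    by (metis eventually_sequentially le_add2)
  have "(\<lambda>i. \<integral>t. \<phi> t * ((exp (- X (i + N) * t) - exp (- x * t)) / (X (i + N) - x)) \<partial>lborel)
        \<longlonglongrightarrow> (\<integral>t. - (t * \<phi> t * exp (- x * t)) \<partial>lborel)"
  proof (rule integral_dominated_convergence[where w = "\<lambda>t. \<bar>t * \<phi> t * exp (- (x / 2) * t)\<bar>"])
    show "integrable lborel (\<lambda>t. \<bar>t * \<phi> t * exp (- (x / 2) * t)\<bar>)"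
      using int1[of "x / 2"] \<open>x > 0\<close> by (intro integrable_abs) auto
    show "AE t in lborel. (\<lambda>i. \<phi> t * ((exp (- X (i + N) * t) - exp (- x * t)) / (X (i + N) - x)))
            \<longlonglongrightarrow> - (t * \<phi> t * exp (- x * t))"
    proof (rule AE_I2)
      fix t :: real
      have "((\<lambda>y. exp (- y * t)) has_real_derivative - t * exp (- x * t)) (at x)"
        by (auto intro!: derivative_eq_intros)
      then have "((\<lambda>y. (exp (- y * t) - exp (- x * t)) / (y - x)) \<longlongrightarrow> - t * exp (- x * t)) (at x)"
        by (simp add: has_field_derivative_iff)
      moreover have "filterlim (\<lambda>i. X (i + N)) (at x) sequentially"
        using LIMSEQ_ignore_initial_segment[OF X] ne by (simp add: filterlim_at)
      ultimately have "(\<lambda>i. (exp (- X (i + N) * t) - exp (- x * t)) / (X (i + N) - x)) \<longlonglongrightarrow> - t * exp (- x * t)"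
        by (rule filterlim_compose)
      then have "(\<lambda>i. \<phi> t * ((exp (- X (i + N) * t) - exp (- x * t)) / (X (i + N) - x))) \<longlonglongrightarrow> \<phi> t * (- t * exp (- x * t))"
        by (rule tendsto_mult_left)
      then show "(\<lambda>i. \<phi> t * ((exp (- X (i + N) * t) - exp (- x * t)) / (X (i + N) - x)))
            \<longlonglongrightarrow> - (t * \<phi> t * exp (- x * t))" by (simp add: mult_ac)
    qed
    show "AE t in lborel. norm (\<phi> t * ((exp (- X (i + N) * t) - exp (- x * t)) / (X (i + N) - x)))
            \<le> \<bar>t * \<phi> t * exp (- (x / 2) * t)\<bar>" for i
    proof (rule AE_I2)
      fix t :: real
      define y where "y = X (i + N)"
      have y: "y > x / 2" "y \<noteq> x" using N ne by (auto simp: y_def)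
      show "norm (\<phi> t * ((exp (- X (i + N) * t) - exp (- x * t)) / (X (i + N) - x)))
            \<le> \<bar>t * \<phi> t * exp (- (x / 2) * t)\<bar>"
      proof (cases "t < 0")
        case False
        then have t: "t \<ge> 0" by simp
        have *: "\<bar>exp (- b * t) - exp (- a * t)\<bar> \<le> t * exp (- (x / 2) * t) * \<bar>b - a\<bar>" if "a > x / 2" "b > x / 2" "a < b" for a b
        proof -
          obtain z where z: "a < z" "z < b" "exp (- b * t) - exp (- a * t) = (b - a) * (- t * exp (- z * t))"
            using MVT2[of a b "\<lambda>y. exp (- y * t)" "\<lambda>y. - t * exp (- y * t)"] \<open>a < b\<close>
            by (force intro!: derivative_eq_intros)
          have "\<bar>exp (- b * t) - exp (- a * t)\<bar> = t * exp (- z * t) * \<bar>b - a\<bar>"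
            unfolding z(3) using t by (simp add: abs_mult)
          also have "exp (- z * t) \<le> exp (- (x / 2) * t)"
            using mult_right_mono[of "x / 2" z t] z that t by simp
          finally show ?thesis using t by (simp add: mult_left_mono mult_right_mono)
        qed
        have "x > x / 2" using \<open>x > 0\<close> by simp
        then have "\<bar>exp (- y * t) - exp (- x * t)\<bar> \<le> t * exp (- (x / 2) * t) * \<bar>y - x\<bar>"
          using *[of x y] *[of y x] y by (cases "x < y") (auto simp: abs_minus_commute)
        then have "\<bar>exp (- y * t) - exp (- x * t)\<bar> / \<bar>y - x\<bar> \<le> t * exp (- (x / 2) * t)"
          using y by (simp add: divide_le_eq)
        then have "\<bar>\<phi> t\<bar> * (\<bar>exp (- y * t) - exp (- x * t)\<bar> / \<bar>y - x\<bar>) \<le> \<bar>\<phi> t\<bar> * (t * exp (- (x / 2) * t))"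
          by (rule mult_left_mono) simp
        then show ?thesis using t unfolding y_def[symmetric] by (simp add: abs_mult mult_ac)
      qed (simp add: supp)
    qed
  qed auto
  also have "(\<lambda>i. \<integral>t. \<phi> t * ((exp (- X (i + N) * t) - exp (- x * t)) / (X (i + N) - x)) \<partial>lborel)
     = (\<lambda>i. ((\<integral>t. \<phi> t * exp (- X (i + N) * t) \<partial>lborel) - (\<integral>t. \<phi> t * exp (- x * t) \<partial>lborel)) / (X (i + N) - x))"
  proof
    fix i
    have "X (i + N) > 0" using N[of i] \<open>x > 0\<close> by linarith
    then have "(\<integral>t. (\<phi> t * exp (- X (i + N) * t) - \<phi> t * exp (- x * t)) / (X (i + N) - x) \<partial>lborel)
      = ((\<integral>t. \<phi> t * exp (- X (i + N) * t) \<partial>lborel) - (\<integral>t. \<phi> t * exp (- x * t) \<partial>lborel)) / (X (i + N) - x)"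
      using \<open>x > 0\<close> int0 by (subst integral_divide_zero) (simp only: Bochner_Integration.integral_diff)
    then show "(\<integral>t. \<phi> t * ((exp (- X (i + N) * t) - exp (- x * t)) / (X (i + N) - x)) \<partial>lborel)
      = ((\<integral>t. \<phi> t * exp (- X (i + N) * t) \<partial>lborel) - (\<integral>t. \<phi> t * exp (- x * t) \<partial>lborel)) / (X (i + N) - x)"
      by (simp add: right_diff_distrib)
  qed
  finally show "(\<lambda>i. ((\<integral>t. \<phi> t * exp (- X i * t) \<partial>lborel) - (\<integral>t. \<phi> t * exp (- x * t) \<partial>lborel)) / (X i - x))
        \<longlonglongrightarrow> - (\<integral>t. t * \<phi> t * exp (- x * t) \<partial>lborel)"
    using LIMSEQ_offset[of "\<lambda>i. ((\<integral>t. \<phi> t * exp (- X i * t) \<partial>lborel) - (\<integral>t. \<phi> t * exp (- x * t) \<partial>lborel)) / (X i - x)"]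
    by simp
qed

section \<open>The Laplace integral as the recessive solution of Kummer's equation\<close>

lemma has_bochner_integral_erlang_density:
  assumes "0 < l"
  shows "has_bochner_integral lborel (erlang_density k l) 1"
  using nn_integral_erlang_ith_moment[OF assms, of k 0] assms
  by (intro has_bochner_integral_nn_integral) auto

lemma erlang_density_scale:
  assumes "0 < c"
  shows "erlang_density k (c * l) x = c * erlang_density k l (c * x)"
  using assms by (simp add: erlang_density_def power_mult_distrib mult_less_0_iff mult_ac)

text \<open>The factor \<open>t^(a-1) * (1+t)^(b-a-1)\<close> of the Laplace integral of Gamma(a)
  U(a,b,x), for \<open>a = k + 1\<close> and \<open>b = k + 2 - n\<close>. The value 0 on the
  negative axis lets all integrals run over \<open>lborel\<close>.\<close>

definition laplace_kernel :: "nat \<Rightarrow> nat \<Rightarrow> real \<Rightarrow> real" where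
  "laplace_kernel k n t = (if t < 0 then 0 else t ^ k / (1 + t) ^ n)"

definition laplace_kernel_integral :: "nat \<Rightarrow> nat \<Rightarrow> real \<Rightarrow> real" where
  "laplace_kernel_integral k n x = (\<integral>t. laplace_kernel k n t * exp (- x * t) \<partial>lborel)"

lemma laplace_kernel_measurable [measurable]: "laplace_kernel k n \<in> borel_measurable borel"
  unfolding laplace_kernel_def[abs_def] by measurable

text \<open>Read as an Erlang average of \<open>1 / (1 + t) ^ n\<close>, the integral inherits its
  integrability and its behaviour for large \<open>x\<close> from the Erlang density. The index
  \<open>k\<close> of \<open>erlang_density\<close> stands for shape \<open>k + 1\<close>.\<close>

lemma laplace_kernel_exp_eq_erlang:
  assumes "x > 0"
  shows "laplace_kernel k n t * exp (- x * t) = fact k / x ^ Suc k * (erlang_density k x t / (1 + t) ^ n)"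
  using assms by (simp add: laplace_kernel_def erlang_density_def)

lemma erlang_over_power_le: "x > 0 \<Longrightarrow> \<bar>erlang_density k x t / (1 + t) ^ n\<bar> \<le> erlang_density k x t"
proof (cases "t < 0")
  case False
  assume "x > 0"
  then have "erlang_density k x t / (1 + t) ^ n \<le> erlang_density k x t / 1"
    using False by (intro divide_left_mono) auto
  then show ?thesis using False \<open>x > 0\<close> by simp
qed (simp add: erlang_density_def)

lemma integrable_erlang_over_power:
  assumes "x > 0"
  shows "integrable lborel (\<lambda>t. erlang_density k x t / (1 + t) ^ n)"
proof (rule Bochner_Integration.integrable_bound)
  show "integrable lborel (erlang_density k x)"
    using has_bochner_integral_erlang_density[OF assms] by (simp add: has_bochner_integral_iff)
  show "AE t in lborel. norm (erlang_density k x t / (1 + t) ^ n) \<le> norm (erlang_density k x t)"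
    using erlang_over_power_le[OF assms, of k _ n] assms by (intro AE_I2) simp
qed measurable

lemma integrable_laplace_kernel:
  assumes "x > 0"
  shows "integrable lborel (\<lambda>t. laplace_kernel k n t * exp (- x * t))"
  unfolding laplace_kernel_exp_eq_erlang[OF assms]
  using integrable_erlang_over_power[OF assms] by (rule integrable_mult_right)

lemma laplace_kernel_Suc: "t * laplace_kernel k n t = laplace_kernel (Suc k) n t"
  by (simp add: laplace_kernel_def)

text \<open>Differentiation brings down a factor \<open>- t\<close>, which only raises
  \<open>k\<close>: both derivatives in Kummer's equation stay within the family.\<close>

lemma laplace_kernel_integral_deriv:
  assumes "x > 0"
  shows "(laplace_kernel_integral k n has_real_derivative - laplace_kernel_integral (Suc k) n x) (at x)"
  using has_real_derivative_laplace[of "laplace_kernel k n" x] integrable_laplace_kernel assms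
  unfolding laplace_kernel_integral_def[abs_def] laplace_kernel_Suc
  by (simp add: laplace_kernel_def del: mult_minus_left)

lemma laplace_kernel_integral_pos:
  assumes "x > 0"
  shows "laplace_kernel_integral k n x > 0"
proof -
  \<comment> \<open>On [1, 2] one has \<open>t ^ k \<ge> 1\<close>,
    \<open>(1 + t) ^ n \<le> 3 ^ n\<close> and \<open>exp (- x * t) \<ge> exp (- x * 2)\<close>, so
    \<open>c\<close> bounds the integrand from below there.\<close>
  define c where "c = exp (- x * 2) / 3 ^ n"
  have "0 < c" by (simp add: c_def)
  also have "c = (\<integral>t. c * indicator {1..2::real} t \<partial>lborel)" by simp
  also have "\<dots> \<le> laplace_kernel_integral k n x"
    unfolding laplace_kernel_integral_def
  proof (rule integral_mono)
    show "integrable lborel (\<lambda>t. c * indicator {1..2::real} t)" by simp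
    show "integrable lborel (\<lambda>t. laplace_kernel k n t * exp (- x * t))"
      by (rule integrable_laplace_kernel[OF assms])
    fix t :: real
    show "c * indicator {1..2} t \<le> laplace_kernel k n t * exp (- x * t)"
    proof (cases "t \<in> {1..2}")
      case True
      have "1 / 3 ^ n \<le> t ^ k / (1 + t) ^ n"
        using True by (intro frac_le one_le_power power_mono) auto
      moreover have "exp (- x * 2) \<le> exp (- x * t)" using True assms by simp
      ultimately have "1 / 3 ^ n * exp (- x * 2) \<le> t ^ k / (1 + t) ^ n * exp (- x * t)"
        using True by (intro mult_mono) auto
      then show ?thesis using True by (simp add: c_def laplace_kernel_def)
    qed (simp add: laplace_kernel_def)
  qed
  finally show ?thesis .
qed

lemma laplace_kernel_integral_recurrence:
  assumes "x > 0"
  shows "real (Suc k) * laplace_kernel_integral k n x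
       + (real k + 2 - real n - x) * laplace_kernel_integral (Suc k) n x
       - x * laplace_kernel_integral (Suc (Suc k)) n x = 0"
proof -
  \<comment> \<open>Kummer's equation under the integral sign: the integrand is the derivative of \<open>F\<close>.\<close>
  define F where "F t = t ^ Suc k * (1 + t) / (1 + t) ^ n * exp (- x * t)" for t
  define f where "f t = (real (Suc k) * (t ^ k / (1 + t) ^ n * exp (- x * t))
       + (real k + 2 - real n - x) * (t ^ Suc k / (1 + t) ^ n * exp (- x * t))
       - x * (t ^ Suc (Suc k) / (1 + t) ^ n * exp (- x * t)))" for t
  \<comment> \<open>\<open>g\<close> is \<open>f\<close> cut off to the left of 0: the fundamental
    theorem applies to \<open>f\<close> on the open half-line, whereas the integral of
    \<open>g\<close> splits into three kernel integrals.\<close>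
  define g where "g t = (real (Suc k) * (laplace_kernel k n t * exp (- x * t))
       + (real k + 2 - real n - x) * (laplace_kernel (Suc k) n t * exp (- x * t))
       - x * (laplace_kernel (Suc (Suc k)) n t * exp (- x * t)))" for t
  note intk = integrable_laplace_kernel[OF assms]
  have g: "integrable lborel g"
    unfolding g_def by (intro Bochner_Integration.integrable_add Bochner_Integration.integrable_diff integrable_mult_right intk)
  have gf: "g t = indicator {0..} t * f t" for t
    by (simp add: g_def f_def laplace_kernel_def)
  have "(LBINT t=0..\<infinity>. f t) = 0 - 0"
  proof (rule interval_integral_FTC_integrable)
    show "(F has_vector_derivative f t) (at t)" if "0 < ereal t" for t
    proof -
      have "t > 0" using that by simp
      then have "1 + t > 0" by simp
      have "((\<lambda>t. 1 + t) has_real_derivative 1) (at t)"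
        by (auto intro!: derivative_eq_intros)
      from DERIV_power[OF this, of n]
      have w: "((\<lambda>t. (1 + t) ^ n) has_real_derivative real n * (1 + t) ^ n / (1 + t)) (at t)"
        using \<open>1 + t > 0\<close> by (cases n) simp_all
      have e: "((\<lambda>t. exp (- x * t)) has_real_derivative - x * exp (- x * t)) (at t)"
        by (auto intro!: derivative_eq_intros)
      have "((\<lambda>t. t ^ Suc k + t ^ Suc (Suc k)) has_real_derivative
          real (Suc k) * t ^ k + real (Suc (Suc k)) * t ^ Suc k) (at t)"
        using DERIV_add[OF DERIV_pow[of "Suc k" t] DERIV_pow[of "Suc (Suc k)" t]] by simp
      from DERIV_divide[OF DERIV_mult[OF this e] w]
      have "((\<lambda>t. (t ^ Suc k + t ^ Suc (Suc k)) * exp (- x * t) / (1 + t) ^ n) has_real_derivative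
          (((real (Suc k) * t ^ k + real (Suc (Suc k)) * t ^ Suc k) * exp (- x * t) +
            - x * exp (- x * t) * (t ^ Suc k + t ^ Suc (Suc k))) * (1 + t) ^ n -
           (t ^ Suc k + t ^ Suc (Suc k)) * exp (- x * t) * (real n * (1 + t) ^ n / (1 + t))) /
           ((1 + t) ^ n * (1 + t) ^ n)) (at t)" (is "(_ has_real_derivative ?D) _")
        using \<open>1 + t > 0\<close> by simp
      moreover have "?D = f t"
      proof -
        define W where "W = (1 + t) ^ n"
        define E where "E = exp (- x * t)"
        have "W \<noteq> 0" using \<open>1 + t > 0\<close> by (simp add: W_def)
        \<comment> \<open>The extra factor \<open>1 + t\<close> in \<open>F\<close> cancels the
          denominator produced by differentiating \<open>(1 + t) ^ n\<close>, so no power of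
          \<open>1 + t\<close> beyond the n-th survives.\<close>
        have "t ^ Suc k + t ^ Suc (Suc k) = t ^ Suc k * (1 + t)" by (simp add: algebra_simps)
        then have "(t ^ Suc k + t ^ Suc (Suc k)) * E * (real n * W / (1 + t)) = t ^ Suc k * E * real n * W"
          using \<open>1 + t > 0\<close> by simp
        then have "?D = (((real (Suc k) * t ^ k + real (Suc (Suc k)) * t ^ Suc k) * E +
            - x * E * (t ^ Suc k + t ^ Suc (Suc k))) * W - t ^ Suc k * E * real n * W) / (W * W)"
          by (simp only: W_def E_def)
        also have "\<dots> = ((real (Suc k) * t ^ k + real (Suc (Suc k)) * t ^ Suc k) * E +
            - x * E * (t ^ Suc k + t ^ Suc (Suc k)) - t ^ Suc k * E * real n) / W"
          unfolding left_diff_distrib[symmetric] using \<open>W \<noteq> 0\<close>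
          by (rule nonzero_mult_divide_mult_cancel_right)
        also have "\<dots> = f t"
          unfolding f_def W_def[symmetric] E_def[symmetric]
          by (simp add: add_divide_distrib diff_divide_distrib algebra_simps)
        finally show ?thesis .
      qed
      moreover have "(t ^ Suc k + t ^ Suc (Suc k)) * exp (- x * t) / (1 + t) ^ n = F t" for t
        by (simp add: F_def algebra_simps)
      ultimately have "(F has_real_derivative f t) (at t)" by simp
      then show ?thesis by (simp add: has_real_derivative_iff_has_vector_derivative)
    qed
    show "isCont f t" if "0 < ereal t" for t
      unfolding f_def using that by (intro continuous_intros) auto
    have "set_integrable lborel {0<..} g"
      unfolding set_integrable_def by (rule integrable_mult_indicator[OF _ g]) simp
    moreover have "(\<lambda>t. indicator {0<..} t *\<^sub>R g t) = (\<lambda>t. indicator {0<..} t *\<^sub>R f t)"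
      by (rule ext) (simp add: gf indicator_def)
    ultimately show "set_integrable lborel (einterval 0 \<infinity>) f"
      unfolding set_integrable_def by (simp add: einterval_def greaterThan_def)
    \<comment> \<open>Both boundary terms vanish: at 0 through the factor \<open>t ^ Suc k\<close>,
      at infinity through the exponential, after \<open>(1 + t) ^ n \<ge> 1\<close> has been
      dropped.\<close>
    have "isCont F 0"
      unfolding F_def by (intro continuous_intros) auto
    then have "F \<midarrow>0\<rightarrow> 0"
      by (simp add: isCont_def F_def)
    then have "(F \<longlongrightarrow> 0) (at_right 0)"
      by (rule filterlim_mono) (simp_all add: at_le)
    then show "((F \<circ> real_of_ereal) \<longlongrightarrow> 0) (at_right 0)"
      by (simp add: zero_ereal_def ereal_tendsto_simps)
    have "((\<lambda>t. t ^ Suc k * exp (- x * t) + t ^ Suc (Suc k) * exp (- x * t)) \<longlongrightarrow> 0) at_top"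
      using assms by real_asymp
    then have "(F \<longlongrightarrow> 0) at_top"
    proof (rule Lim_null_comparison[rotated])
      show "\<forall>\<^sub>F t in at_top. norm (F t) \<le> t ^ Suc k * exp (- x * t) + t ^ Suc (Suc k) * exp (- x * t)"
        using eventually_gt_at_top[of 0]
      proof eventually_elim
        case (elim t)
        have "norm (F t) = (t ^ Suc k * (1 + t) * exp (- x * t)) / (1 + t) ^ n"
          using elim by (simp add: F_def abs_mult)
        also have "\<dots> \<le> (t ^ Suc k * (1 + t) * exp (- x * t)) / 1"
          using elim by (intro divide_left_mono) auto
        finally show ?case by (simp add: algebra_simps)
      qed
    qed
    then show "((F \<circ> real_of_ereal) \<longlongrightarrow> 0) (at_left \<infinity>)"
      by (simp add: ereal_tendsto_simps)
  qed simp
  also have "(LBINT t=0..\<infinity>. f t) = (\<integral>t. indicator {0<..} t * f t \<partial>lborel)"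
    by (simp add: interval_lebesgue_integral_def set_lebesgue_integral_def einterval_def greaterThan_def)
  also have "\<dots> = integral\<^sup>L lborel g"
  proof (rule integral_cong_AE)
    show "AE t in lborel. indicator {0<..} t * f t = g t"
      using AE_lborel_singleton[of "0::real"]
      by eventually_elim (auto simp: gf indicator_def)
    show "(\<lambda>t. indicator {0<..} t * f t) \<in> borel_measurable lborel"
      unfolding f_def by measurable
    show "g \<in> borel_measurable lborel" using g by auto
  qed
  also have "\<dots> = real (Suc k) * laplace_kernel_integral k n x
       + (real k + 2 - real n - x) * laplace_kernel_integral (Suc k) n x
       - x * laplace_kernel_integral (Suc (Suc k)) n x"
    unfolding g_def laplace_kernel_integral_def
    by (simp only: intk integrable_mult_right Bochner_Integration.integrable_add Bochner_Integration.integral_add Bochner_Integration.integral_diff integral_mult_right_zero)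
  finally show ?thesis by simp
qed

text \<open>An Erlang law of rate \<open>x\<close> concentrates at 0 as \<open>x\<close> grows.
  Substituting \<open>t / x\<close> for \<open>t\<close> fixes the density and moves
  \<open>x\<close> into \<open>(1 + t / x) ^ n\<close>, so a single Erlang density
  dominates.\<close>

lemma erlang_over_power_tendsto:
  "((\<lambda>x. \<integral>t. erlang_density k x t / (1 + t) ^ n \<partial>lborel) \<longlongrightarrow> 1) at_top"
proof -
  have "((\<lambda>x. \<integral>t. erlang_density k 1 t / (1 + inverse x * t) ^ n \<partial>lborel) \<longlongrightarrow> (\<integral>t. erlang_density k 1 t \<partial>lborel)) at_top"
  proof (rule integral_dominated_convergence_at_top[where w = "erlang_density k 1"])
    show "integrable lborel (erlang_density k 1)"
      using has_bochner_integral_erlang_density[of 1 k] by (simp add: has_bochner_integral_iff)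
    show "\<forall>\<^sub>F x in at_top. AE t in lborel. norm (erlang_density k 1 t / (1 + inverse x * t) ^ n) \<le> erlang_density k 1 t"
      using eventually_gt_at_top[of 0]
    proof eventually_elim
      case (elim x)
      show ?case
      proof (rule AE_I2)
        fix t :: real
        show "norm (erlang_density k 1 t / (1 + inverse x * t) ^ n) \<le> erlang_density k 1 t"
        proof (cases "t < 0")
          case False
          then have "erlang_density k 1 t / (1 + inverse x * t) ^ n \<le> erlang_density k 1 t / 1"
            using elim False by (intro divide_left_mono) (auto intro!: zero_less_power add_pos_nonneg)
          then show ?thesis using False elim by simp
        qed (simp add: erlang_density_def)
      qed
    qed
    show "AE t in lborel. ((\<lambda>x. erlang_density k 1 t / (1 + inverse x * t) ^ n) \<longlongrightarrow> erlang_density k 1 t) at_top"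
    proof (rule AE_I2)
      fix t :: real
      have "((\<lambda>x. erlang_density k 1 t / (1 + inverse x * t) ^ n) \<longlongrightarrow> erlang_density k 1 t / (1 + 0 * t) ^ n) at_top"
        by (intro tendsto_intros tendsto_inverse_0_at_top filterlim_ident) auto
      then show "((\<lambda>x. erlang_density k 1 t / (1 + inverse x * t) ^ n) \<longlongrightarrow> erlang_density k 1 t) at_top" by simp
    qed
  qed measurable
  also have "(\<integral>t. erlang_density k 1 t \<partial>lborel) = 1"
    using has_bochner_integral_erlang_density[of 1 k] by (simp add: has_bochner_integral_iff)
  finally show ?thesis
  proof (rule Lim_transform_eventually)
    show "\<forall>\<^sub>F x in at_top. (\<integral>t. erlang_density k 1 t / (1 + inverse x * t) ^ n \<partial>lborel)
             = (\<integral>t. erlang_density k x t / (1 + t) ^ n \<partial>lborel)"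
      using eventually_gt_at_top[of 0]
    proof eventually_elim
      case (elim x)
      have "(\<integral>t. erlang_density k 1 t / (1 + inverse x * t) ^ n \<partial>lborel)
         = x * (\<integral>t. erlang_density k 1 (x * t) / (1 + inverse x * (x * t)) ^ n \<partial>lborel)"
        using lborel_integral_real_affine[of x "\<lambda>t. erlang_density k 1 t / (1 + inverse x * t) ^ n" 0] elim by simp
      also have "\<dots> = (\<integral>t. x * erlang_density k 1 (x * t) / (1 + inverse x * (x * t)) ^ n \<partial>lborel)"
        by (simp flip: integral_mult_right_zero)
      also have "\<dots> = (\<integral>t. erlang_density k x t / (1 + t) ^ n \<partial>lborel)"
        using elim erlang_density_scale[of x k 1] by (simp add: mult.assoc[symmetric])
      finally show ?case .
    qed
  qed
qed

lemma erlang_over_power_eq_kernel_integral: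
  assumes "x > 0"
  shows "(\<integral>t. erlang_density k x t / (1 + t) ^ n \<partial>lborel) = x ^ Suc k * (laplace_kernel_integral k n x / fact k)"
  using assms unfolding laplace_kernel_integral_def laplace_kernel_exp_eq_erlang[OF assms]
  by (subst integral_mult_right_zero) simp

text \<open>Kummer's equation is the recurrence divided by \<open>- fact k\<close>; the
  normalisation at infinity is the concentration limit, as \<open>x ^ Suc k / fact k\<close>
  completes the kernel to an Erlang density.\<close>

lemma kummer_recessive_laplace_kernel:
  "kummer_recessive (real (Suc k)) (real k + 2 - real n) (\<lambda>x. laplace_kernel_integral k n x / fact k)"
  unfolding kummer_recessive_def
proof (intro conjI exI allI impI)
  fix t :: real assume t: "t > 0"
  show "((\<lambda>x. laplace_kernel_integral k n x / fact k) has_real_derivative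
          - laplace_kernel_integral (Suc k) n t / fact k) (at t)"
    by (rule DERIV_cdivide[OF laplace_kernel_integral_deriv[OF t]])
  have "((\<lambda>x. - laplace_kernel_integral (Suc k) n x) has_real_derivative
          - (- laplace_kernel_integral (Suc (Suc k)) n t)) (at t)"
    by (rule DERIV_minus[OF laplace_kernel_integral_deriv[OF t]])
  from DERIV_cdivide[OF this, of "fact k"]
  show "((\<lambda>t. - laplace_kernel_integral (Suc k) n t / fact k) has_real_derivative
          laplace_kernel_integral (Suc (Suc k)) n t / fact k) (at t)"
    by simp
  have "t * (laplace_kernel_integral (Suc (Suc k)) n t / fact k)
      + (real k + 2 - real n - t) * (- laplace_kernel_integral (Suc k) n t / fact k)
      - real (Suc k) * (laplace_kernel_integral k n t / fact k)
      = - (real (Suc k) * laplace_kernel_integral k n t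
       + (real k + 2 - real n - t) * laplace_kernel_integral (Suc k) n t
       - t * laplace_kernel_integral (Suc (Suc k)) n t) / fact k"
    by (simp add: field_simps)
  then show "t * (laplace_kernel_integral (Suc (Suc k)) n t / fact k)
      + (real k + 2 - real n - t) * (- laplace_kernel_integral (Suc k) n t / fact k)
      - real (Suc k) * (laplace_kernel_integral k n t / fact k) = 0"
    unfolding laplace_kernel_integral_recurrence[OF t] by simp
next
  show "((\<lambda>t. t powr real (Suc k) * (laplace_kernel_integral k n t / fact k)) \<longlongrightarrow> 1) at_top"
  proof (rule Lim_transform_eventually[OF erlang_over_power_tendsto[of k n]])
    show "\<forall>\<^sub>F x in at_top. (\<integral>t. erlang_density k x t / (1 + t) ^ n \<partial>lborel)
        = x powr real (Suc k) * (laplace_kernel_integral k n x / fact k)"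
      using eventually_gt_at_top[of 0]
      by eventually_elim (simp only: erlang_over_power_eq_kernel_integral powr_realpow)
  qed
qed

text \<open>The form in which \<open>tricomi_U\<close> enters the product formula: one Erlang
  density integrated against a power that will be the transform of another.\<close>

lemma integral_erlang_over_power:
  assumes "x > 0"
  shows "(\<integral>t. erlang_density k x t / (1 + t) ^ n \<partial>lborel)
           = x ^ Suc k * tricomi_U (real (Suc k)) (real k + 2 - real n) x"
  using tricomi_U_eqI[OF kummer_recessive_laplace_kernel[of k n] _ assms] laplace_kernel_integral_pos
    erlang_over_power_eq_kernel_integral[OF assms]
  by simp

section \<open>Laplace transforms of densities\<close>

text \<open>A density together with a closed form of its transform. The transform is a nonnegative
  integral, so Tonelli applies directly, and its value \<open>ennreal (L l)\<close> makes it finite.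
  At negative arguments \<open>L\<close> is arbitrary up to measurability; there it always meets a
  density that is 0.\<close>

definition has_laplace :: "(real \<Rightarrow> real) \<Rightarrow> (real \<Rightarrow> real) \<Rightarrow> bool" where
  "has_laplace f L \<longleftrightarrow> f \<in> borel_measurable borel \<and> L \<in> borel_measurable borel \<and>
     (\<forall>x. 0 \<le> f x) \<and> (\<forall>x<0. f x = 0) \<and>
     (\<forall>l\<ge>0. 0 \<le> L l \<and> (\<integral>\<^sup>+x. ennreal (f x * exp (- (l * x))) \<partial>lborel) = ennreal (L l))"

lemma has_laplaceD:
  assumes "has_laplace f L"
  shows "f \<in> borel_measurable borel" "L \<in> borel_measurable borel" "0 \<le> f x" "x < 0 \<Longrightarrow> f x = 0"
    "l \<ge> 0 \<Longrightarrow> 0 \<le> L l"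
    "l \<ge> 0 \<Longrightarrow> (\<integral>\<^sup>+x. ennreal (f x * exp (- (l * x))) \<partial>lborel) = ennreal (L l)"
  using assms by (auto simp: has_laplace_def)

lemma has_laplace_integrable:
  assumes "has_laplace f L"
  shows "integrable lborel f"
  using has_laplaceD[OF assms] has_laplaceD(6)[OF assms, of 0]
  by (intro integrableI_nonneg) auto

text \<open>The kernel \<open>exp (- (c * x * y))\<close> is symmetric in \<open>x\<close> and
  \<open>y\<close>, so both single integrals are the same double integral, taken in the two orders.
  The double integral is kept visible because it is what independence yields for the
  expectation.\<close>

lemma laplace_swap_nn:
  assumes f: "has_laplace f L" and g: "has_laplace g K" and "c \<ge> 0"
  shows "(\<integral>\<^sup>+y. ennreal (g y * L (c * y)) \<partial>lborel) = (\<integral>\<^sup>+y. \<integral>\<^sup>+x. ennreal (g y * f x * exp (- (c * x * y))) \<partial>lborel \<partial>lborel)"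
    and "(\<integral>\<^sup>+y. \<integral>\<^sup>+x. ennreal (g y * f x * exp (- (c * x * y))) \<partial>lborel \<partial>lborel) = (\<integral>\<^sup>+x. ennreal (f x * K (c * x)) \<partial>lborel)"
proof -
  note [measurable] = has_laplaceD(1)[OF f] has_laplaceD(1)[OF g]
  \<comment> \<open>Stated for arbitrary pairs, so that it serves in both orders of
    integration.\<close>
  have *: "ennreal (g y * L (c * y)) = (\<integral>\<^sup>+x. ennreal (g y * f x * exp (- (c * x * y))) \<partial>lborel)"
    if f: "has_laplace f L" and g: "has_laplace g K" for f g L K y
  proof (cases "y < 0")
    case False
    note [measurable] = has_laplaceD(1)[OF f] has_laplaceD(1)[OF g]
    from False \<open>c \<ge> 0\<close> have "c * y \<ge> 0" by simp
    have "ennreal (g y * L (c * y)) = ennreal (g y) * (\<integral>\<^sup>+x. ennreal (f x * exp (- (c * y * x))) \<partial>lborel)"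
      using has_laplaceD(5,6)[OF f \<open>c * y \<ge> 0\<close>] has_laplaceD(3)[OF g] by (simp add: ennreal_mult)
    also have "\<dots> = (\<integral>\<^sup>+x. ennreal (g y) * ennreal (f x * exp (- (c * y * x))) \<partial>lborel)"
      by (rule nn_integral_cmult[symmetric]) measurable
    also have "\<dots> = (\<integral>\<^sup>+x. ennreal (g y * f x * exp (- (c * x * y))) \<partial>lborel)"
      using has_laplaceD(3)[OF f] has_laplaceD(3)[OF g] by (simp add: ennreal_mult mult_ac)
    finally show ?thesis .
  qed (simp add: has_laplaceD(4)[OF g])
  show "(\<integral>\<^sup>+y. ennreal (g y * L (c * y)) \<partial>lborel) = (\<integral>\<^sup>+y. \<integral>\<^sup>+x. ennreal (g y * f x * exp (- (c * x * y))) \<partial>lborel \<partial>lborel)"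
    by (simp add: *[OF f g])
  have "(\<integral>\<^sup>+y. \<integral>\<^sup>+x. ennreal (g y * f x * exp (- (c * x * y))) \<partial>lborel \<partial>lborel)
      = (\<integral>\<^sup>+x. \<integral>\<^sup>+y. ennreal (g y * f x * exp (- (c * x * y))) \<partial>lborel \<partial>lborel)"
    by (rule lborel_pair.Fubini') measurable
  also have "\<dots> = (\<integral>\<^sup>+x. ennreal (f x * K (c * x)) \<partial>lborel)"
    unfolding *[OF g f] by (simp add: mult_ac)
  finally show "(\<integral>\<^sup>+y. \<integral>\<^sup>+x. ennreal (g y * f x * exp (- (c * x * y))) \<partial>lborel \<partial>lborel) = (\<integral>\<^sup>+x. ennreal (f x * K (c * x)) \<partial>lborel)" .
qed

lemma integral_laplace_eq_nn_integral:
  assumes f: "has_laplace f L" and g: "has_laplace g K" and "c \<ge> 0"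
  shows "(\<integral>y. g y * L (c * y) \<partial>lborel) = enn2real (\<integral>\<^sup>+y. ennreal (g y * L (c * y)) \<partial>lborel)"
proof (rule integral_eq_nn_integral)
  note [measurable] = has_laplaceD(1,2)[OF f] has_laplaceD(1)[OF g]
  show "(\<lambda>y. g y * L (c * y)) \<in> borel_measurable lborel" by measurable
  show "AE y in lborel. 0 \<le> g y * L (c * y)"
  proof (rule AE_I2)
    fix y show "0 \<le> g y * L (c * y)"
      using has_laplaceD(3,4)[OF g, of y] has_laplaceD(5)[OF f, of "c * y"] \<open>c \<ge> 0\<close>
      by (cases "y < 0") simp_all
  qed
qed

text \<open>Bochner integrals, since the expansions that it connects have coefficients of both
  signs.\<close>

lemma laplace_swap:
  assumes f: "has_laplace f L" and g: "has_laplace g K" and "c \<ge> 0"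
  shows "(\<integral>y. g y * L (c * y) \<partial>lborel) = (\<integral>x. f x * K (c * x) \<partial>lborel)"
  unfolding integral_laplace_eq_nn_integral[OF assms] integral_laplace_eq_nn_integral[OF g f \<open>c \<ge> 0\<close>]
  by (simp only: laplace_swap_nn[OF assms])

lemma has_laplace_scale:
  assumes f: "has_laplace f L" and "d > 0"
  shows "has_laplace (\<lambda>x. f (x / d) / d) (\<lambda>l. L (d * l))"
  unfolding has_laplace_def
proof (intro conjI allI impI)
  note [measurable] = has_laplaceD(1,2)[OF f]
  show "(\<lambda>x. f (x / d) / d) \<in> borel_measurable borel" "(\<lambda>l. L (d * l)) \<in> borel_measurable borel"
    by measurable
  show "0 \<le> f (x / d) / d" for x using has_laplaceD(3)[OF f] \<open>d > 0\<close> by simp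
  show "f (x / d) / d = 0" if "x < 0" for x
    using has_laplaceD(4)[OF f, of "x / d"] that \<open>d > 0\<close> by (simp add: divide_less_0_iff)
  fix l :: real assume "0 \<le> l"
  then have dl: "0 \<le> d * l" using \<open>d > 0\<close> by simp
  then show "0 \<le> L (d * l)" by (rule has_laplaceD(5)[OF f])
  have "(\<integral>\<^sup>+x. ennreal (f (x / d) / d * exp (- (l * x))) \<partial>lborel)
      = ennreal \<bar>d\<bar> * (\<integral>\<^sup>+x. ennreal (f ((0 + d * x) / d) / d * exp (- (l * (0 + d * x)))) \<partial>lborel)"
    using \<open>d > 0\<close> by (intro nn_integral_real_affine) auto
  also have "\<dots> = (\<integral>\<^sup>+x. ennreal \<bar>d\<bar> * ennreal (f ((0 + d * x) / d) / d * exp (- (l * (0 + d * x)))) \<partial>lborel)"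
    by (rule nn_integral_cmult[symmetric]) measurable
  also have "\<dots> = (\<integral>\<^sup>+x. ennreal (f x * exp (- (d * l * x))) \<partial>lborel)"
    using \<open>d > 0\<close> has_laplaceD(3)[OF f] by (simp add: mult_ac flip: ennreal_mult)
  also have "\<dots> = ennreal (L (d * l))" by (rule has_laplaceD(6)[OF f dl])
  finally show "(\<integral>\<^sup>+x. ennreal (f (x / d) / d * exp (- (l * x))) \<partial>lborel) = ennreal (L (d * l))" .
qed

text \<open>Exponential tilting changes only the rate of an Erlang law; the normalising factor left
  over is its Laplace transform.\<close>

lemma erlang_density_times_exp:
  assumes "l > - 1"
  shows "erlang_density k 1 x * exp (- (l * x)) = erlang_density k (1 + l) x / (1 + l) ^ Suc k"
proof (cases "x < 0")
  case False
  have "exp (- x) * exp (- (l * x)) = exp ((- 1 - l) * x)"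
    unfolding exp_add[symmetric] by (simp add: algebra_simps)
  then show ?thesis using False assms by (simp add: erlang_density_def)
qed (simp add: erlang_density_def)

lemma nn_integral_erlang_times_exp:
  assumes "l \<ge> 0" "c \<ge> 0"
  shows "(\<integral>\<^sup>+x. ennreal (c * erlang_density k 1 x * exp (- (l * x))) \<partial>lborel) = ennreal (c / (1 + l) ^ Suc k)"
proof -
  have "has_bochner_integral lborel (\<lambda>x. c / (1 + l) ^ Suc k * erlang_density k (1 + l) x) (c / (1 + l) ^ Suc k * 1)"
    using assms by (intro has_bochner_integral_mult_right has_bochner_integral_erlang_density) simp
  then have "(\<integral>\<^sup>+x. ennreal (c / (1 + l) ^ Suc k * erlang_density k (1 + l) x) \<partial>lborel) = ennreal (c / (1 + l) ^ Suc k * 1)"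
    using assms by (subst nn_integral_eq_integral) (auto simp: has_bochner_integral_iff)
  moreover have "c * erlang_density k 1 x * exp (- (l * x)) = c / (1 + l) ^ Suc k * erlang_density k (1 + l) x" for x
    using erlang_density_times_exp[of l k x] assms by (simp only: mult.assoc) simp
  ultimately show ?thesis by simp
qed

lemma has_laplace_erlang:
  assumes "w > 0"
  shows "has_laplace (erlang_density k (1 / w)) (\<lambda>l. 1 / (1 + w * l) ^ Suc k)"
proof -
  have "has_laplace (erlang_density k 1) (\<lambda>l. 1 / (1 + l) ^ Suc k)"
    unfolding has_laplace_def using nn_integral_erlang_times_exp[of _ 1 k]
    by (auto simp: erlang_density_def)
  moreover have "erlang_density k 1 (x / w) / w = erlang_density k (1 / w) x" for x
    using erlang_density_scale[of "1 / w" k 1] assms by simp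
  ultimately show ?thesis
    using has_laplace_scale[of "erlang_density k 1" "\<lambda>l. 1 / (1 + l) ^ Suc k" w] assms by simp
qed

section \<open>Convergence, continuity and monotonicity of the Kummer series\<close>

lemma kummer_1F1_summable:
  assumes "b > 0"
  shows "summable (\<lambda>n. pochhammer a n / pochhammer b n / fact n * z ^ n :: real)"
proof -
  \<comment> \<open>Since \<open>\<bar>a + n\<bar> \<le> (\<bar>a\<bar> / b + 1) * (b + n)\<close>,
    consecutive terms have ratio at most \<open>B / (n + 1)\<close>, which is at most 1/2 once
    \<open>n \<ge> 2 * B\<close>.\<close>
  define B where "B = (\<bar>a\<bar> / b + 1) * \<bar>z\<bar>"
  obtain N :: nat where N: "2 * B \<le> real N"
    using real_arch_simple by blast
  show ?thesis
  proof (rule summable_ratio_test[of "1/2" N])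
    fix n assume "n \<ge> N"
    have "\<bar>a + real n\<bar> \<le> (\<bar>a\<bar> / b + 1) * (b + real n)"
    proof -
      have "(\<bar>a\<bar> / b + 1) * (b + real n) = \<bar>a\<bar> + b + \<bar>a\<bar> / b * real n + real n"
        using assms by (simp add: field_simps)
      moreover have "0 \<le> \<bar>a\<bar> / b * real n" using assms by simp
      ultimately show ?thesis using assms by linarith
    qed
    then have "\<bar>a + real n\<bar> / (b + real n) \<le> \<bar>a\<bar> / b + 1"
      using assms by (simp add: divide_le_eq)
    then have "\<bar>a + real n\<bar> / (b + real n) * \<bar>z\<bar> \<le> B"
      unfolding B_def by (rule mult_right_mono) simp
    also have "\<dots> \<le> (real n + 1) / 2"
    proof -
      have "B \<le> real N / 2" using N by simp
      also have "\<dots> \<le> (real n + 1) / 2" using \<open>n \<ge> N\<close> by simp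
      finally show ?thesis .
    qed
    finally have "\<bar>a + real n\<bar> / (b + real n) * \<bar>z\<bar> / (real n + 1) \<le> (real n + 1) / 2 / (real n + 1)"
      by (rule divide_right_mono) simp
    also have "\<dots> = 1 / 2" by simp
    finally have r: "\<bar>a + real n\<bar> / (b + real n) * \<bar>z\<bar> / (real n + 1) \<le> 1 / 2" .
    have p: "pochhammer b n > 0" using assms by (rule pochhammer_pos)
    have "norm (pochhammer a (Suc n) / pochhammer b (Suc n) / fact (Suc n) * z ^ Suc n)
       = (\<bar>a + real n\<bar> / (b + real n) * \<bar>z\<bar> / (real n + 1)) * norm (pochhammer a n / pochhammer b n / fact n * z ^ n)"
      using assms p by (simp add: pochhammer_Suc abs_mult power_abs ac_simps)
    also have "\<dots> \<le> 1 / 2 * norm (pochhammer a n / pochhammer b n / fact n * z ^ n)"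
      by (rule mult_right_mono[OF r]) simp
    finally show "norm (pochhammer a (Suc n) / pochhammer b (Suc n) / fact (Suc n) * z ^ Suc n)
        \<le> 1 / 2 * norm (pochhammer a n / pochhammer b n / fact n * z ^ n)" .
  qed simp
qed

lemma kummer_1F1_altdef: "kummer_1F1 a b z = (\<Sum>n. pochhammer a n / pochhammer b n / fact n * z ^ n)"
  by (simp add: kummer_1F1_def)

lemma isCont_kummer_1F1:
  assumes "b > 0"
  shows "isCont (kummer_1F1 a b) z"
  unfolding kummer_1F1_altdef[abs_def]
  using kummer_1F1_summable[OF assms] by (intro isCont_powser_converges_everywhere) auto

lemma kummer_1F1_measurable [measurable]:
  assumes "b > 0"
  shows "kummer_1F1 a b \<in> borel_measurable borel"
  using isCont_kummer_1F1[OF assms] by (intro borel_measurable_continuous_onI continuous_at_imp_continuous_on) auto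

lemma pochhammer_nonneg_of_nonneg: "a \<ge> 0 \<Longrightarrow> 0 \<le> pochhammer (a :: real) n"
  by (cases "a = 0") (simp_all add: pochhammer_0_left less_imp_le pochhammer_pos)

text \<open>All coefficients are nonnegative. Monotonicity later supplies the dominating
  density.\<close>

lemma kummer_1F1_mono:
  assumes "a \<ge> 0" "b > 0" "0 \<le> y" "y \<le> z"
  shows "0 \<le> kummer_1F1 a b y" "kummer_1F1 a b y \<le> kummer_1F1 a b z"
proof -
  have p: "0 \<le> pochhammer a n / pochhammer b n / fact n" for n
    using assms pochhammer_nonneg_of_nonneg[of a n] pochhammer_pos[of b n] by simp
  show "0 \<le> kummer_1F1 a b y"
    unfolding kummer_1F1_altdef using p assms
    by (intro suminf_nonneg kummer_1F1_summable mult_nonneg_nonneg zero_le_power)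
  show "kummer_1F1 a b y \<le> kummer_1F1 a b z"
    unfolding kummer_1F1_altdef using p assms
    by (intro suminf_le kummer_1F1_summable mult_left_mono power_mono) auto
qed

text \<open>Newton's binomial series with exponent \<open>- m\<close>; the sign of the generalised
  binomial coefficient cancels that of \<open>(- z) ^ n\<close>.\<close>

lemma negative_binomial_sums:
  fixes z :: real
  assumes "\<bar>z\<bar> < 1"
  shows "(\<lambda>n. pochhammer (real m) n / fact n * z ^ n) sums (1 / (1 - z) ^ m)"
proof -
  have "(\<lambda>n. ((- real m) gchoose n) * (- z) ^ n) sums (1 + - z) powr (- real m)"
    using assms by (intro gen_binomial_real) simp
  also have "(\<lambda>n. ((- real m) gchoose n) * (- z) ^ n) = (\<lambda>n. pochhammer (real m) n / fact n * z ^ n)"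
  proof
    fix n
    have "(- 1) ^ n * (- z) ^ n = z ^ n" by (simp flip: power_mult_distrib)
    then show "((- real m) gchoose n) * (- z) ^ n = pochhammer (real m) n / fact n * z ^ n"
      by (simp add: gbinomial_pochhammer)
  qed
  also have "(1 + - z) powr (- real m) = 1 / (1 - z) ^ m"
    using assms by (simp add: powr_minus powr_realpow divide_inverse)
  finally show ?thesis .
qed

section \<open>The \<open>\<kappa>\<close>-\<open>\<mu>\<close> shadowed density\<close>

text \<open>The density with scale \<open>\<Delta>\<^sub>1\<close> normalised to \<open>1\<close>, with shape \<open>\<mu> = Suc k\<close> and \<open>q = \<mu>\<kappa> / (\<mu>\<kappa> + m)\<close>.\<close>

definition unit_kms_density :: "nat \<Rightarrow> nat \<Rightarrow> real \<Rightarrow> real \<Rightarrow> real" where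
  "unit_kms_density k m q u = (1 - q) ^ m * erlang_density k 1 u * kummer_1F1 (real m) (real (Suc k)) (q * u)"

text \<open>A quotient of natural powers, because the exponent \<open>m - \<mu>\<close> of
  \<open>1 + l\<close> can be negative. The factor \<open>1 / (1 - q)\<close> is the ratio of
  \<Delta>2 to \<Delta>1.\<close>

definition kms_laplace :: "nat \<Rightarrow> nat \<Rightarrow> real \<Rightarrow> real \<Rightarrow> real" where
  "kms_laplace k m q l = (1 + l) ^ m / ((1 + l) ^ Suc k * (1 + l / (1 - q)) ^ m)"

lemma unit_kms_density_measurable [measurable]: "unit_kms_density k m q \<in> borel_measurable borel"
proof -
  have [measurable]: "kummer_1F1 (real m) (real (Suc k)) \<in> borel_measurable borel"
    by (rule kummer_1F1_measurable) simp
  show ?thesis unfolding unit_kms_density_def[abs_def] by measurable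
qed

lemma unit_kms_density_nonneg:
  assumes "0 \<le> q" "q < 1"
  shows "0 \<le> unit_kms_density k m q u"
proof (cases "u < 0")
  case False
  then show ?thesis
    using assms kummer_1F1_mono(1)[of "real m" "real (Suc k)" "q * u" "q * u"]
    by (simp add: unit_kms_density_def)
qed (simp add: unit_kms_density_def erlang_density_def)

text \<open>The Pochhammer symbol in the denominator of the Kummer series is exactly the ratio of
  the factorials normalising the two Erlang densities.\<close>

lemma erlang_density_times_monomial:
  "u ^ n / pochhammer (real (Suc k)) n * erlang_density k 1 u = erlang_density (k + n) 1 u"
proof -
  have "fact k * pochhammer (real (Suc k)) n = fact (k + n)"
    by (simp add: pochhammer_fact pochhammer_product' [of "1::real" k n] add.commute)
  then show ?thesis
    by (simp add: erlang_density_def power_add field_simps)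
qed

text \<open>For \<open>0 \<le> q < 1\<close> the weights are the negative binomial probabilities
  with parameters \<open>m\<close> and \<open>1 - q\<close>.\<close>

lemma unit_kms_density_sums:
  "(\<lambda>n. (1 - q) ^ m * (pochhammer (real m) n / fact n * q ^ n) * erlang_density (k + n) 1 u)
     sums unit_kms_density k m q u"
proof -
  have "(\<lambda>n. pochhammer (real m) n / pochhammer (real (Suc k)) n / fact n * (q * u) ^ n)
          sums kummer_1F1 (real m) (real (Suc k)) (q * u)"
    unfolding kummer_1F1_altdef by (intro summable_sums kummer_1F1_summable) simp
  then have "(\<lambda>n. (1 - q) ^ m * erlang_density k 1 u *
               (pochhammer (real m) n / pochhammer (real (Suc k)) n / fact n * (q * u) ^ n))
          sums unit_kms_density k m q u"
    unfolding unit_kms_density_def by (rule sums_mult)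
  moreover have "(1 - q) ^ m * erlang_density k 1 u *
               (pochhammer (real m) n / pochhammer (real (Suc k)) n / fact n * (q * u) ^ n)
      = (1 - q) ^ m * (pochhammer (real m) n / fact n * q ^ n) * erlang_density (k + n) 1 u" for n
    unfolding erlang_density_times_monomial[symmetric] by (simp add: power_mult_distrib ac_simps)
  ultimately show ?thesis by simp
qed

text \<open>Each Erlang component contributes \<open>1 / (1 + l) ^ Suc (k + n)\<close>, so the
  transformed series is again negative binomial, now in \<open>q / (1 + l)\<close>.\<close>

lemma has_laplace_unit_kms_density:
  assumes q: "0 \<le> q" "q < 1"
  shows "has_laplace (unit_kms_density k m q) (kms_laplace k m q)"
  unfolding has_laplace_def
proof (intro conjI allI impI)
  show "unit_kms_density k m q \<in> borel_measurable borel" by measurable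
  show "kms_laplace k m q \<in> borel_measurable borel" unfolding kms_laplace_def[abs_def] by measurable
  show "0 \<le> unit_kms_density k m q x" for x by (rule unit_kms_density_nonneg[OF q])
  show "unit_kms_density k m q x = 0" if "x < 0" for x
    using that by (simp add: unit_kms_density_def erlang_density_def)
  fix l :: real assume l: "0 \<le> l"
  then show "0 \<le> kms_laplace k m q l" using q by (simp add: kms_laplace_def)
  define w where "w n = (1 - q) ^ m * (pochhammer (real m) n / fact n * q ^ n)" for n
  have w: "0 \<le> w n" for n
    using q pochhammer_nonneg_of_nonneg[of "real m" n] by (simp add: w_def)
  have "\<bar>q / (1 + l)\<bar> < 1" using q l by simp
  then have "(\<lambda>n. pochhammer (real m) n / fact n * (q / (1 + l)) ^ n) sums (1 / (1 - q / (1 + l)) ^ m)"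
    by (rule negative_binomial_sums)
  then have "(\<lambda>n. (1 - q) ^ m / (1 + l) ^ Suc k * (pochhammer (real m) n / fact n * (q / (1 + l)) ^ n))
      sums ((1 - q) ^ m / (1 + l) ^ Suc k * (1 / (1 - q / (1 + l)) ^ m))"
    by (rule sums_mult)
  also have "(\<lambda>n. (1 - q) ^ m / (1 + l) ^ Suc k * (pochhammer (real m) n / fact n * (q / (1 + l)) ^ n))
      = (\<lambda>n. w n / (1 + l) ^ Suc (k + n))"
    by (simp add: w_def power_divide power_add fun_eq_iff)
  also have "(1 - q) ^ m / (1 + l) ^ Suc k * (1 / (1 - q / (1 + l)) ^ m) = kms_laplace k m q l"
  proof -
    \<comment> \<open>Isolating \<open>1 - q\<close> lets its m-th power cancel against the weight
      and exposes the second pole.\<close>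
    have "1 - q / (1 + l) = (1 - q) * (1 + l / (1 - q)) / (1 + l)"
    proof -
      have "(1 - q) * (1 + l / (1 - q)) = 1 + l - q"
        using q by (simp add: distrib_left)
      then show ?thesis using l by (simp add: diff_divide_distrib)
    qed
    then show ?thesis
      using q by (simp add: kms_laplace_def power_divide power_mult_distrib)
  qed
  finally have S: "(\<lambda>n. w n / (1 + l) ^ Suc (k + n)) sums kms_laplace k m q l" .
  have "(\<integral>\<^sup>+x. ennreal (unit_kms_density k m q x * exp (- (l * x))) \<partial>lborel)
      = (\<integral>\<^sup>+x. (\<Sum>n. ennreal (w n * erlang_density (k + n) 1 x * exp (- (l * x)))) \<partial>lborel)"
  proof (rule nn_integral_cong)
    fix x :: real
    have "(\<lambda>n. w n * erlang_density (k + n) 1 x * exp (- (l * x))) sums (unit_kms_density k m q x * exp (- (l * x)))"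
      unfolding w_def by (rule sums_mult2[OF unit_kms_density_sums])
    then show "ennreal (unit_kms_density k m q x * exp (- (l * x)))
        = (\<Sum>n. ennreal (w n * erlang_density (k + n) 1 x * exp (- (l * x))))"
      using w by (intro sums_unique sums_ennreal[THEN iffD2]) (auto simp: unit_kms_density_nonneg[OF q])
  qed
  also have "\<dots> = (\<Sum>n. \<integral>\<^sup>+x. ennreal (w n * erlang_density (k + n) 1 x * exp (- (l * x))) \<partial>lborel)"
    by (rule nn_integral_suminf) measurable
  also have "\<dots> = (\<Sum>n. ennreal (w n / (1 + l) ^ Suc (k + n)))"
    using nn_integral_erlang_times_exp[OF l w] by simp
  also have "\<dots> = ennreal (kms_laplace k m q l)"
    using S w l q by (intro sums_unique[symmetric] sums_ennreal[THEN iffD2]) (auto simp: kms_laplace_def)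
  finally show "(\<integral>\<^sup>+x. ennreal (unit_kms_density k m q x * exp (- (l * x))) \<partial>lborel) = ennreal (kms_laplace k m q l)" .
qed

lemma mix_q_bounds:
  assumes "\<kappa> \<ge> 0" "m \<ge> 1"
  shows "0 \<le> mix_q \<kappa> \<mu> m" "mix_q \<kappa> \<mu> m < 1" "1 - mix_q \<kappa> \<mu> m = mix_p \<kappa> \<mu> m"
proof -
  have "0 \<le> real \<mu> * \<kappa>" "0 < real m" using assms by simp_all
  then have "0 < real \<mu> * \<kappa> + real m" by linarith
  with \<open>0 \<le> real \<mu> * \<kappa>\<close> \<open>0 < real m\<close> show "0 \<le> mix_q \<kappa> \<mu> m" "mix_q \<kappa> \<mu> m < 1" "1 - mix_q \<kappa> \<mu> m = mix_p \<kappa> \<mu> m"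
    by (simp_all add: mix_q_def mix_p_def field_simps)
qed

lemma mix_\<Delta>1_pos:
  assumes "\<gamma> > 0" "\<kappa> \<ge> 0" "\<mu> \<ge> 1"
  shows "mix_\<Delta>1 \<gamma> \<kappa> \<mu> > 0"
  using assms by (simp add: mix_\<Delta>1_def)

lemma mix_\<Delta>2_eq: "mix_\<Delta>2 \<gamma> \<kappa> \<mu> m = mix_\<Delta>1 \<gamma> \<kappa> \<mu> / mix_p \<kappa> \<mu> m"
  by (simp add: mix_\<Delta>1_def mix_\<Delta>2_def mix_p_def ac_simps)

text \<open>The origin is excluded: there \<open>kms_density\<close> is 0, whereas for
  \<open>k = 0\<close> the Erlang factor is not.\<close>

lemma kms_density_eq_unit:
  assumes "\<gamma> > 0" "\<kappa> \<ge> 0" "m \<ge> 1" "x \<noteq> 0"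
  shows "kms_density \<gamma> \<kappa> (real (Suc k)) (real m) x
           = unit_kms_density k m (mix_q \<kappa> (Suc k) m) (x / mix_\<Delta>1 \<gamma> \<kappa> (Suc k)) / mix_\<Delta>1 \<gamma> \<kappa> (Suc k)"
proof (cases "x > 0")
  case True
  define N where "N = real (Suc k)"
  define D where "D = N * \<kappa> + real m"
  have N: "N > 0" by (simp add: N_def)
  have D: "D > 0" using N assms by (simp add: D_def add_nonneg_pos)
  have z: "mix_q \<kappa> (Suc k) m * (x / mix_\<Delta>1 \<gamma> \<kappa> (Suc k)) = N\<^sup>2 * \<kappa> * (1 + \<kappa>) / (N * \<kappa> + real m) * (x / \<gamma>)"
    by (simp add: mix_q_def mix_\<Delta>1_def N_def power2_eq_square)
  have q: "1 - mix_q \<kappa> (Suc k) m = real m / D"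
    using mix_q_bounds(3)[of \<kappa> m "Suc k"] assms by (simp add: mix_p_def D_def N_def)
  have y: "x / mix_\<Delta>1 \<gamma> \<kappa> (Suc k) = N * (1 + \<kappa>) * x / \<gamma>"
    by (simp add: mix_\<Delta>1_def N_def)
  have ypos: "N * (1 + \<kappa>) * x / \<gamma> > 0" using N True assms by simp
  have E: "erlang_density k 1 (N * (1 + \<kappa>) * x / \<gamma>) / mix_\<Delta>1 \<gamma> \<kappa> (Suc k)
     = (N * (1 + \<kappa>)) ^ Suc k / (fact k * \<gamma>) * (x / \<gamma>) ^ k * exp (- (N * (1 + \<kappa>) * x / \<gamma>))"
  proof -
    \<comment> \<open>\<open>W\<close> stands for \<open>N * (1 + \<kappa>)\<close>, kept as an atom
      during simplification.\<close>
    have "erlang_density k 1 (W * x / \<gamma>) / (\<gamma> / W) = W ^ Suc k / (fact k * \<gamma>) * (x / \<gamma>) ^ k * exp (- (W * x / \<gamma>))"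
      if "W * x / \<gamma> > 0" for W
      using that by (simp add: erlang_density_def power_mult_distrib power_divide mult_ac)
    from this[OF ypos] show ?thesis by (simp add: mix_\<Delta>1_def N_def)
  qed
  have "kms_density \<gamma> \<kappa> N (real m) x = N ^ Suc k * real m ^ m * (1 + \<kappa>) ^ Suc k / (fact k * \<gamma> * D ^ m)
      * (x / \<gamma>) ^ k * exp (- (N * (1 + \<kappa>) * x / \<gamma>))
      * kummer_1F1 (real m) N (N\<^sup>2 * \<kappa> * (1 + \<kappa>) / (N * \<kappa> + real m) * (x / \<gamma>))"
  proof -
    have "Gamma N = fact k" unfolding N_def of_nat_Suc by (rule Gamma_fact)
    moreover have "N powr N = N ^ Suc k" "(1 + \<kappa>) powr N = (1 + \<kappa>) ^ Suc k"
      using N assms powr_realpow[of N "Suc k"] powr_realpow[of "1 + \<kappa>" "Suc k"] by (simp_all add: N_def)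
    moreover have "real m powr real m = real m ^ m" "(N * \<kappa> + real m) powr real m = D ^ m"
      using D assms by (simp_all add: powr_realpow D_def)
    moreover have "(x / \<gamma>) powr (N - 1) = (x / \<gamma>) ^ k"
      using True assms by (simp add: N_def powr_realpow)
    ultimately show ?thesis using True by (simp only: kms_density_def if_True)
  qed
  also have "\<dots> = (real m / D) ^ m * ((N * (1 + \<kappa>)) ^ Suc k / (fact k * \<gamma>) * (x / \<gamma>) ^ k * exp (- (N * (1 + \<kappa>) * x / \<gamma>)))
      * kummer_1F1 (real m) N (N\<^sup>2 * \<kappa> * (1 + \<kappa>) / (N * \<kappa> + real m) * (x / \<gamma>))"
    by (simp add: power_divide power_mult_distrib mult_ac)
  also have "\<dots> = unit_kms_density k m (mix_q \<kappa> (Suc k) m) (x / mix_\<Delta>1 \<gamma> \<kappa> (Suc k)) / mix_\<Delta>1 \<gamma> \<kappa> (Suc k)"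
    unfolding unit_kms_density_def z unfolding q y E[symmetric] by (simp add: N_def)
  finally show ?thesis by (simp only: N_def)
next
  case False
  with assms have "x < 0" by simp
  then have "x / mix_\<Delta>1 \<gamma> \<kappa> (Suc k) < 0"
    using mix_\<Delta>1_pos[of \<gamma> \<kappa> "Suc k"] assms by (simp add: divide_less_0_iff)
  then show ?thesis using False by (simp add: kms_density_def unit_kms_density_def erlang_density_def)
qed

text \<open>A version of the density, equal to \<open>kms_density\<close> off the origin, in the
  scaled form to which the transform lemmas apply.\<close>

definition kms_law :: "real \<Rightarrow> real \<Rightarrow> nat \<Rightarrow> nat \<Rightarrow> real \<Rightarrow> real" where
  "kms_law \<gamma> \<kappa> k m x = unit_kms_density k m (mix_q \<kappa> (Suc k) m) (x / mix_\<Delta>1 \<gamma> \<kappa> (Suc k)) / mix_\<Delta>1 \<gamma> \<kappa> (Suc k)"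

lemma has_laplace_kms_law:
  assumes "\<gamma> > 0" "\<kappa> \<ge> 0" "m \<ge> 1"
  shows "has_laplace (kms_law \<gamma> \<kappa> k m) (\<lambda>l. kms_laplace k m (mix_q \<kappa> (Suc k) m) (mix_\<Delta>1 \<gamma> \<kappa> (Suc k) * l))"
  unfolding kms_law_def[abs_def] using assms mix_q_bounds[of \<kappa> m "Suc k"]
  by (intro has_laplace_scale has_laplace_unit_kms_density mix_\<Delta>1_pos) auto

section \<open>The moment-generating function of a product of independent variables\<close>

lemma (in prob_space) indep_var_nn_integral:
  assumes indep: "indep_var borel X borel Y"
    and g: "g \<in> borel_measurable (borel \<Otimes>\<^sub>M borel)"
  shows "(\<integral>\<^sup>+\<omega>. g (X \<omega>, Y \<omega>) \<partial>M) = (\<integral>\<^sup>+\<omega>'. \<integral>\<^sup>+\<omega>. g (X \<omega>, Y \<omega>') \<partial>M \<partial>M)"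
proof -
  note [measurable] = indep_var_rv1[OF indep] indep_var_rv2[OF indep] g
  have joint: "distr M (borel \<Otimes>\<^sub>M borel) (\<lambda>\<omega>. (X \<omega>, Y \<omega>)) = distr M borel X \<Otimes>\<^sub>M distr M borel Y"
    using indep by (simp add: indep_var_distribution_eq)
  interpret dX: prob_space "distr M borel X" by (rule prob_space_distr) measurable
  interpret dY: prob_space "distr M borel Y" by (rule prob_space_distr) measurable
  interpret pair_prob_space "distr M borel X" "distr M borel Y" ..
  have "(\<integral>\<^sup>+\<omega>. g (X \<omega>, Y \<omega>) \<partial>M) = (\<integral>\<^sup>+p. g p \<partial>distr M (borel \<Otimes>\<^sub>M borel) (\<lambda>\<omega>. (X \<omega>, Y \<omega>)))"
    by (subst nn_integral_distr) auto
  also note joint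
  also have "(\<integral>\<^sup>+p. g p \<partial>(distr M borel X \<Otimes>\<^sub>M distr M borel Y))
      = (\<integral>\<^sup>+y. \<integral>\<^sup>+x. g (x, y) \<partial>distr M borel X \<partial>distr M borel Y)"
    by (rule nn_integral_snd[symmetric]) measurable
  also have "\<dots> = (\<integral>\<^sup>+\<omega>'. \<integral>\<^sup>+\<omega>. g (X \<omega>, Y \<omega>') \<partial>M \<partial>M)"
    by (simp add: nn_integral_distr)
  finally show ?thesis .
qed

text \<open>Integrating out \<open>X\<close> for fixed \<open>Y = y\<close> gives the transform at
  \<open>- s * y\<close>, a nonnegative argument because \<open>s < 0\<close>. The given densities
  \<open>f0\<close> and \<open>g0\<close> may differ from \<open>f\<close> and \<open>g\<close> at
  0, a null set.\<close>

lemma mgf_product_eq_laplace: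
  assumes P: "prob_space P" and indep: "prob_space.indep_var P borel X borel Y"
    and X: "distributed P lborel X (\<lambda>x. ennreal (f0 x))" and Y: "distributed P lborel Y (\<lambda>x. ennreal (g0 x))"
    and f: "has_laplace f L" and g: "has_laplace g K"
    and f0: "\<And>x. x \<noteq> 0 \<Longrightarrow> f0 x = f x" and g0: "\<And>x. x \<noteq> 0 \<Longrightarrow> g0 x = g x"
    and "s < 0"
  shows "mgf P (\<lambda>\<omega>. X \<omega> * Y \<omega>) s = (\<integral>y. g y * L (- s * y) \<partial>lborel)"
proof -
  interpret prob_space P by fact
  note [measurable] = indep_var_rv1[OF indep] indep_var_rv2[OF indep] has_laplaceD(1)[OF f] has_laplaceD(1)[OF g]
  have expect: "(\<integral>\<^sup>+\<omega>. h (Z \<omega>) \<partial>P) = (\<integral>\<^sup>+x. ennreal (r x) * h x \<partial>lborel)"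
    if "distributed P lborel Z (\<lambda>x. ennreal (r0 x))" and "h \<in> borel_measurable borel"
      and "\<And>x. x \<noteq> 0 \<Longrightarrow> r0 x = r x" for Z h and r0 r :: "real \<Rightarrow> real"
  proof -
    have "(\<integral>\<^sup>+\<omega>. h (Z \<omega>) \<partial>P) = (\<integral>\<^sup>+x. ennreal (r0 x) * h x \<partial>lborel)"
      using that by (intro distributed_nn_integral[symmetric]) auto
    also have "\<dots> = (\<integral>\<^sup>+x. ennreal (r x) * h x \<partial>lborel)"
      using AE_lborel_singleton[of "0::real"] by (intro nn_integral_cong_AE) (auto simp: that(3))
    finally show ?thesis .
  qed
  have "mgf P (\<lambda>\<omega>. X \<omega> * Y \<omega>) s = enn2real (\<integral>\<^sup>+\<omega>. ennreal (exp (s * (X \<omega> * Y \<omega>))) \<partial>P)"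
    unfolding mgf_def by (rule integral_eq_nn_integral) auto
  also have "(\<integral>\<^sup>+\<omega>. ennreal (exp (s * (X \<omega> * Y \<omega>))) \<partial>P) = (\<integral>\<^sup>+\<omega>'. \<integral>\<^sup>+\<omega>. ennreal (exp (s * (X \<omega> * Y \<omega>'))) \<partial>P \<partial>P)"
    using indep_var_nn_integral[OF indep, of "\<lambda>(x, y). ennreal (exp (s * (x * y)))"] by simp
  also have "\<dots> = (\<integral>\<^sup>+\<omega>'. \<integral>\<^sup>+x. ennreal (f x) * ennreal (exp (s * (x * Y \<omega>'))) \<partial>lborel \<partial>P)"
    by (intro nn_integral_cong expect[OF X] f0) measurable
  also have "\<dots> = (\<integral>\<^sup>+y. ennreal (g y) * (\<integral>\<^sup>+x. ennreal (f x) * ennreal (exp (s * (x * y))) \<partial>lborel) \<partial>lborel)"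
    by (intro expect[OF Y] g0) measurable
  also have "\<dots> = (\<integral>\<^sup>+y. \<integral>\<^sup>+x. ennreal (g y * f x * exp (- (- s * x * y))) \<partial>lborel \<partial>lborel)"
    using has_laplaceD(3)[OF f] has_laplaceD(3)[OF g]
    by (simp add: ennreal_mult mult.assoc flip: nn_integral_cmult)
  also have "\<dots> = (\<integral>\<^sup>+y. ennreal (g y * L (- s * y)) \<partial>lborel)"
    using \<open>s < 0\<close> by (intro laplace_swap_nn(1)[OF f g, symmetric]) simp
  also have "enn2real \<dots> = (\<integral>y. g y * L (- s * y) \<partial>lborel)"
    using \<open>s < 0\<close> by (intro integral_laplace_eq_nn_integral[OF f g, symmetric]) simp
  finally show ?thesis .
qed

section \<open>Partial fractions\<close>

text \<open>The identity \<open>(1-x) * (1-x)^(-m-2) = (1-x)^(-m-1)\<close> for power series,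
  truncated at degree \<open>a\<close>; truncation leaves one boundary term.\<close>

lemma choose_sum_shift:
  fixes x y :: "'a :: comm_ring_1"
  assumes "x + y = 1"
  shows "y * (\<Sum>k\<le>a. of_nat (Suc m + k choose k) * x ^ k)
       = (\<Sum>k\<le>a. of_nat (m + k choose k) * x ^ k) - x ^ Suc a * of_nat (Suc a + m choose Suc m)"
proof (induction a)
  case 0
  have "y = 1 - x" using assms by (simp add: algebra_simps)
  then show ?case by simp
next
  case (Suc a)
  \<comment> \<open>\<open>P\<close> is the boundary coefficient for \<open>Suc a\<close>. By
    symmetry it is also the newest coefficient on the left (\<open>P1\<close>); by Pascal's rule it
    is the newest coefficient on the right plus the old boundary coefficient
    (\<open>P2\<close>).\<close>
  define P :: 'a where "P = of_nat (Suc (Suc a) + m choose Suc m)"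
  have y: "y = 1 - x" using assms by (simp add: algebra_simps)
  have "(Suc m + Suc a choose Suc a) = (Suc (Suc a) + m choose Suc m)"
    by (subst binomial_symmetric) (simp_all add: add.commute)
  then have P1: "of_nat (Suc m + Suc a choose Suc a) = P"
    unfolding P_def by (rule arg_cong)
  have P2: "of_nat (m + Suc a choose Suc a) + of_nat (Suc a + m choose Suc m) = P"
  proof -
    have "(m + Suc a choose Suc a) = (Suc a + m choose m)"
      by (subst binomial_symmetric) (simp_all add: add.commute)
    then have "(m + Suc a choose Suc a) + (Suc a + m choose Suc m) = (Suc (Suc a) + m choose Suc m)"
      by simp
    then show ?thesis unfolding P_def of_nat_add[symmetric] by (rule arg_cong)
  qed
  have "y * (\<Sum>k\<le>Suc a. of_nat (Suc m + k choose k) * x ^ k)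
      = (\<Sum>k\<le>a. of_nat (m + k choose k) * x ^ k) - x ^ Suc a * of_nat (Suc a + m choose Suc m) + y * (P * x ^ Suc a)"
    by (simp add: distrib_left Suc.IH P1 del: power_Suc add_Suc add_Suc_right binomial_Suc_Suc)
  also have "\<dots> = (\<Sum>k\<le>a. of_nat (m + k choose k) * x ^ k) - x ^ Suc a * of_nat (Suc a + m choose Suc m)
      + P * x ^ Suc a - x ^ Suc (Suc a) * P"
    unfolding y by (simp add: algebra_simps del: binomial_Suc_Suc)
  also have "P * x ^ Suc a = of_nat (m + Suc a choose Suc a) * x ^ Suc a + x ^ Suc a * of_nat (Suc a + m choose Suc m)"
    unfolding P2[symmetric] by (simp only: distrib_left mult.commute[of _ "x ^ Suc a"])
  finally show ?case
    by (simp add: P_def del: power_Suc add_Suc add_Suc_right binomial_Suc_Suc)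
qed

text \<open>For probabilities \<open>x\<close> and \<open>y\<close>: in repeated trials either
  \<open>Suc a\<close> successes precede the \<open>Suc m\<close>-th failure or the reverse. In the
  induction on \<open>m\<close>, the term added to the first sum is the boundary term that
  \<open>choose_sum_shift\<close> removes from the second.\<close>

lemma Chaundy_Bullard:
  fixes x y :: "'a :: comm_ring_1"
  assumes "x + y = 1"
  shows "x ^ Suc a * (\<Sum>k\<le>m. of_nat (a + k choose k) * y ^ k)
       + y ^ Suc m * (\<Sum>k\<le>a. of_nat (m + k choose k) * x ^ k) = 1"
proof (induction m)
  case 0
  have y: "y = 1 - x" using assms by (simp add: algebra_simps)
  show ?case using sum_gp_basic[of x a] by (simp add: y)
next
  case (Suc m)
  define S where "S = (\<Sum>k\<le>m. of_nat (a + k choose k) * y ^ k)"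
  define C :: 'a where "C = of_nat (Suc a + m choose Suc m)"
  define T where "T m = (\<Sum>k\<le>a. of_nat (m + k choose k) * x ^ k)" for m
  have shift: "y * T (Suc m) = T m - x ^ Suc a * C"
    unfolding T_def C_def by (rule choose_sum_shift[OF assms])
  have "(\<Sum>k\<le>Suc m. of_nat (a + k choose k) * y ^ k) = S + C * y ^ Suc m"
    by (simp add: S_def C_def)
  then have "x ^ Suc a * (\<Sum>k\<le>Suc m. of_nat (a + k choose k) * y ^ k) + y ^ Suc (Suc m) * T (Suc m)
      = x ^ Suc a * (S + C * y ^ Suc m) + y ^ Suc m * (y * T (Suc m))"
    by (simp add: mult_ac)
  also have "\<dots> = x ^ Suc a * S + y ^ Suc m * T m"
    unfolding shift by (simp add: algebra_simps)
  also have "\<dots> = 1" using Suc.IH by (simp only: S_def T_def)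
  finally show ?case by (simp only: T_def)
qed

lemma partial_fraction_two_poles:
  fixes u v p q :: "'a :: field"
  assumes v: "v = q + p * u" and "u \<noteq> 0" "v \<noteq> 0" "q \<noteq> 0"
  shows "1 / (v ^ Suc a * u ^ Suc m)
     = (\<Sum>k\<le>a. (-1) ^ Suc m * of_nat (m + k choose k) * p ^ Suc m / q ^ (Suc m + k) / v ^ (Suc a - k))
     + (\<Sum>k\<le>m. (-1) ^ k * of_nat (a + k choose k) * p ^ k / q ^ (Suc a + k) / u ^ (Suc m - k))"
proof -
  \<comment> \<open>The Chaundy--Bullard identity for \<open>x + y = 1\<close>, divided by \<open>v\<^bsup>a+1\<^esup> u\<^bsup>m+1\<^esup>\<close>.\<close>
  define x where "x = v / q"
  define y where "y = - p * u / q"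
  \<comment> \<open>The letters stand for whole powers, so the common factors \<open>U\<close> and
    \<open>V\<close> cancel without any manipulation of exponents.\<close>
  have cancel: "(S * P * U / Q) * (B * (V / K)) / ((W * V) * U) = S * B * P / (Q * K) / W"
    if "U \<noteq> 0" "V \<noteq> 0" for U V S P Q B K W :: 'a
    using that by (simp add: ac_simps)
  have "x + y = 1" using assms by (simp add: x_def y_def field_simps)
  from Chaundy_Bullard[OF this, of a m]
  have "1 / (v ^ Suc a * u ^ Suc m) =
      (x ^ Suc a * (\<Sum>k\<le>m. of_nat (a + k choose k) * y ^ k)
       + y ^ Suc m * (\<Sum>k\<le>a. of_nat (m + k choose k) * x ^ k)) / (v ^ Suc a * u ^ Suc m)"
    by simp
  also have "\<dots> = (\<Sum>k\<le>a. y ^ Suc m * (of_nat (m + k choose k) * x ^ k) / (v ^ Suc a * u ^ Suc m))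
       + (\<Sum>k\<le>m. x ^ Suc a * (of_nat (a + k choose k) * y ^ k) / (v ^ Suc a * u ^ Suc m))"
    by (simp add: add_divide_distrib sum_distrib_left sum_divide_distrib del: power_Suc)
  also have "(\<Sum>k\<le>a. y ^ Suc m * (of_nat (m + k choose k) * x ^ k) / (v ^ Suc a * u ^ Suc m))
     = (\<Sum>k\<le>a. (-1) ^ Suc m * of_nat (m + k choose k) * p ^ Suc m / q ^ (Suc m + k) / v ^ (Suc a - k))"
  proof (rule sum.cong[OF refl])
    fix k assume "k \<in> {..a}"
    \<comment> \<open>The factor \<open>v ^ k\<close> from \<open>x ^ k\<close> lowers the pole
      order from \<open>Suc a\<close> to \<open>Suc a - k\<close>, while \<open>y ^ Suc m\<close>
      removes the pole at \<open>u = 0\<close> altogether.\<close>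
    then have "v ^ Suc a = v ^ (Suc a - k) * v ^ k" by (simp flip: power_add)
    moreover have "y ^ Suc m = (-1) ^ Suc m * p ^ Suc m * u ^ Suc m / q ^ Suc m"
      unfolding y_def by (simp only: power_divide power_mult_distrib flip: mult_minus1[of p])
    ultimately show "y ^ Suc m * (of_nat (m + k choose k) * x ^ k) / (v ^ Suc a * u ^ Suc m)
       = (-1) ^ Suc m * of_nat (m + k choose k) * p ^ Suc m / q ^ (Suc m + k) / v ^ (Suc a - k)"
      using cancel[of "u ^ Suc m" "v ^ k" "(-1) ^ Suc m" "p ^ Suc m" "q ^ Suc m" "of_nat (m + k choose k)" "q ^ k"] assms
      by (simp only: x_def power_divide power_add) simp
  qed
  also have "(\<Sum>k\<le>m. x ^ Suc a * (of_nat (a + k choose k) * y ^ k) / (v ^ Suc a * u ^ Suc m))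
     = (\<Sum>k\<le>m. (-1) ^ k * of_nat (a + k choose k) * p ^ k / q ^ (Suc a + k) / u ^ (Suc m - k))"
  proof (rule sum.cong[OF refl])
    fix k assume "k \<in> {..m}"
    then have "u ^ Suc m = u ^ (Suc m - k) * u ^ k" by (simp flip: power_add)
    moreover have "y ^ k = (-1) ^ k * p ^ k * u ^ k / q ^ k"
      unfolding y_def by (simp only: power_divide power_mult_distrib flip: mult_minus1[of p])
    ultimately show "x ^ Suc a * (of_nat (a + k choose k) * y ^ k) / (v ^ Suc a * u ^ Suc m)
       = (-1) ^ k * of_nat (a + k choose k) * p ^ k / q ^ (Suc a + k) / u ^ (Suc m - k)"
      using cancel[of "v ^ Suc a" "u ^ k" "(-1) ^ k" "p ^ k" "q ^ Suc a" "of_nat (a + k choose k)" "q ^ k"] assms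
      by (simp only: x_def power_divide power_add) (simp add: ac_simps)
  qed
  finally show ?thesis .
qed

text \<open>The index layout of the mixture for \<open>m < \<mu>\<close>: the placeholder 0, then
  the poles of scale \<Delta>1, then those of scale \<Delta>2.\<close>

lemma sum_atMost_split:
  fixes f :: "nat \<Rightarrow> 'a :: comm_monoid_add"
  shows "(\<Sum>i=0..Suc a + Suc m. f i) = f 0 + ((\<Sum>k\<le>a. f (Suc k)) + (\<Sum>k\<le>m. f (Suc (Suc a) + k)))"
proof (induction m)
  case 0
  have "(\<Sum>i=0..Suc (Suc a). f i) = f 0 + (\<Sum>k\<le>Suc a. f (Suc k))"
    by (simp only: atLeast0AtMost sum.atMost_Suc_shift)
  then show ?case by simp
qed (simp add: ac_simps)

section \<open>The product distribution\<close>

text \<open>With \<open>v = 1 + \<Delta>1 * l\<close> and \<open>u = 1 + \<Delta>2 * l\<close>, the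
  transform is \<open>1 / (v^(\<mu>-m) * u^m)\<close> for \<open>m < \<mu>\<close>, expanded in
  partial fractions, and \<open>v^(m-\<mu>) / u^m\<close> otherwise, where
  \<open>v = q + p * u\<close> is expanded by the binomial theorem.\<close>

lemma kms_laplace_mixture:
  assumes "\<gamma> > 0" "\<kappa> \<ge> 0" "\<mu> \<ge> 1" "m \<ge> 1" "m < \<mu> \<longrightarrow> \<kappa> > 0" "l \<ge> 0"
  shows "kms_laplace (\<mu> - 1) m (mix_q \<kappa> \<mu> m) (mix_\<Delta>1 \<gamma> \<kappa> \<mu> * l)
       = (\<Sum>i=0..mix_M \<mu> m. mix_C \<kappa> \<mu> m i / (1 + mix_\<Omega> \<gamma> \<kappa> \<mu> m i * l) ^ mix_m \<mu> m i)"
proof -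
  define p where "p = mix_p \<kappa> \<mu> m"
  define q where "q = mix_q \<kappa> \<mu> m"
  define v where "v = 1 + mix_\<Delta>1 \<gamma> \<kappa> \<mu> * l"
  define u where "u = 1 + mix_\<Delta>2 \<gamma> \<kappa> \<mu> m * l"
  have p: "p = 1 - q" "p > 0"
    using mix_q_bounds[of \<kappa> m \<mu>] assms by (simp_all add: p_def q_def)
  have D: "mix_\<Delta>1 \<gamma> \<kappa> \<mu> > 0" using assms by (intro mix_\<Delta>1_pos)
  have "v > 0" using D assms by (simp add: v_def add_pos_nonneg)
  have u_eq: "u = 1 + mix_\<Delta>1 \<gamma> \<kappa> \<mu> * l / (1 - q)"
    using p by (simp add: u_def mix_\<Delta>2_eq p_def)
  then have "u > 0" using D assms p by (simp add: add_pos_nonneg)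
  have v: "v = q + p * u" using p by (simp add: u_eq v_def distrib_left)
  have L: "kms_laplace (\<mu> - 1) m (mix_q \<kappa> \<mu> m) (mix_\<Delta>1 \<gamma> \<kappa> \<mu> * l) = v ^ m / (v ^ \<mu> * u ^ m)"
    using assms by (simp add: kms_laplace_def v_def u_eq q_def del: power_Suc)
  show ?thesis
  proof (cases "m < \<mu>")
    case True
    then obtain a where "\<mu> = m + Suc a" using less_imp_Suc_add by fastforce
    moreover obtain n where m: "m = Suc n" using assms by (cases m) auto
    ultimately have \<mu>: "\<mu> = Suc a + Suc n" by simp
    have "\<kappa> > 0" using True assms by simp
    \<comment> \<open>Partial fractions divide by powers of \<open>q\<close>; for
      \<open>q = 0\<close> one would have \<open>v = u\<close> and only one pole.\<close>
    then have "q > 0" using assms by (simp add: q_def mix_q_def add_nonneg_pos)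
    have powi: "q powi (- int j) = 1 / q ^ j" for j
      by (simp add: power_int_minus divide_inverse)
    have "kms_laplace (\<mu> - 1) m (mix_q \<kappa> \<mu> m) (mix_\<Delta>1 \<gamma> \<kappa> \<mu> * l) = 1 / (v ^ Suc a * u ^ Suc n)"
      unfolding L unfolding m \<mu> using \<open>v > 0\<close> by (simp add: power_add)
    also have "\<dots> = (\<Sum>k\<le>a. (-1) ^ Suc n * real (n + k choose k) * p ^ Suc n / q ^ (Suc n + k) / v ^ (Suc a - k))
     + (\<Sum>k\<le>n. (-1) ^ k * real (a + k choose k) * p ^ k / q ^ (Suc a + k) / u ^ (Suc n - k))"
      using \<open>v > 0\<close> \<open>u > 0\<close> \<open>q > 0\<close> by (intro partial_fraction_two_poles v) auto
    also have "(\<Sum>k\<le>a. (-1) ^ Suc n * real (n + k choose k) * p ^ Suc n / q ^ (Suc n + k) / v ^ (Suc a - k))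
      = (\<Sum>k\<le>a. mix_C \<kappa> \<mu> m (Suc k) / (1 + mix_\<Omega> \<gamma> \<kappa> \<mu> m (Suc k) * l) ^ mix_m \<mu> m (Suc k))"
    proof (rule sum.cong[OF refl])
      fix k assume k: "k \<in> {..a}"
      have "Suc k \<le> \<mu> - m" using k by (simp add: m \<mu>)
      then have "mix_C \<kappa> \<mu> m (Suc k) = (-1) ^ m * real ((m + Suc k - 2) choose (Suc k - 1)) * p ^ m
          * q powi (- int m - int (Suc k) + 1)"
        using True by (simp only: mix_C_def p_def q_def if_True if_False nat.distinct)
      moreover have "- int m - int (Suc k) + 1 = - int (Suc n + k)" "m + Suc k - 2 = n + k" "Suc k - 1 = k"
        by (simp_all add: m)
      ultimately have "mix_C \<kappa> \<mu> m (Suc k) = (-1) ^ Suc n * real (n + k choose k) * p ^ Suc n / q ^ (Suc n + k)"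
        by (simp only: powi m times_divide_eq_right mult_1_right)
      moreover have "mix_m \<mu> m (Suc k) = Suc a - k" "mix_\<Omega> \<gamma> \<kappa> \<mu> m (Suc k) = mix_\<Delta>1 \<gamma> \<kappa> \<mu>"
        using k by (auto simp: mix_m_def mix_\<Omega>_def m \<mu>)
      ultimately show "(-1) ^ Suc n * real (n + k choose k) * p ^ Suc n / q ^ (Suc n + k) / v ^ (Suc a - k)
        = mix_C \<kappa> \<mu> m (Suc k) / (1 + mix_\<Omega> \<gamma> \<kappa> \<mu> m (Suc k) * l) ^ mix_m \<mu> m (Suc k)"
        by (simp only: v_def)
    qed
    also have "(\<Sum>k\<le>n. (-1) ^ k * real (a + k choose k) * p ^ k / q ^ (Suc a + k) / u ^ (Suc n - k))
      = (\<Sum>k\<le>n. mix_C \<kappa> \<mu> m (Suc (Suc a) + k) / (1 + mix_\<Omega> \<gamma> \<kappa> \<mu> m (Suc (Suc a) + k) * l) ^ mix_m \<mu> m (Suc (Suc a) + k))"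
    proof (rule sum.cong[OF refl])
      fix k assume k: "k \<in> {..n}"
      define i where "i = Suc (Suc a) + k"
      have "\<not> i \<le> \<mu> - m" "i \<noteq> 0" by (simp_all add: m \<mu> i_def)
      then have "mix_C \<kappa> \<mu> m i = (-1) ^ (i + m - \<mu> - 1) * real ((i - 2) choose (i + m - \<mu> - 1))
          * p ^ (i + m - \<mu> - 1) * q powi (- int i + 1)"
        using True by (simp only: mix_C_def p_def q_def if_True if_False)
      moreover have "- int i + 1 = - int (Suc a + k)" "i - 2 = a + k" "i + m - \<mu> - 1 = k"
        by (simp_all add: i_def m \<mu>)
      ultimately have "mix_C \<kappa> \<mu> m (Suc (Suc a) + k) = (-1) ^ k * real (a + k choose k) * p ^ k / q ^ (Suc a + k)"
        by (simp only: powi i_def times_divide_eq_right mult_1_right)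
      moreover have "mix_m \<mu> m (Suc (Suc a) + k) = Suc n - k" "mix_\<Omega> \<gamma> \<kappa> \<mu> m (Suc (Suc a) + k) = mix_\<Delta>2 \<gamma> \<kappa> \<mu> m"
        using k by (auto simp: mix_m_def mix_\<Omega>_def m \<mu>)
      ultimately show "(-1) ^ k * real (a + k choose k) * p ^ k / q ^ (Suc a + k) / u ^ (Suc n - k)
        = mix_C \<kappa> \<mu> m (Suc (Suc a) + k) / (1 + mix_\<Omega> \<gamma> \<kappa> \<mu> m (Suc (Suc a) + k) * l) ^ mix_m \<mu> m (Suc (Suc a) + k)"
        by (simp only: u_def)
    qed
    \<comment> \<open>The index 0 can be added freely because its coefficient is 0.\<close>
    also have "(\<Sum>k\<le>a. mix_C \<kappa> \<mu> m (Suc k) / (1 + mix_\<Omega> \<gamma> \<kappa> \<mu> m (Suc k) * l) ^ mix_m \<mu> m (Suc k))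
      + (\<Sum>k\<le>n. mix_C \<kappa> \<mu> m (Suc (Suc a) + k) / (1 + mix_\<Omega> \<gamma> \<kappa> \<mu> m (Suc (Suc a) + k) * l) ^ mix_m \<mu> m (Suc (Suc a) + k))
      = (\<Sum>i=0..Suc a + Suc n. mix_C \<kappa> \<mu> m i / (1 + mix_\<Omega> \<gamma> \<kappa> \<mu> m i * l) ^ mix_m \<mu> m i)"
      unfolding sum_atMost_split using True by (simp add: mix_C_def)
    finally show ?thesis using True by (simp only: mix_M_def if_True \<mu>)
  next
    case False
    then have le: "\<mu> \<le> m" by simp
    have "v ^ m / (v ^ \<mu> * u ^ m) = v ^ (m - \<mu>) / u ^ m"
      using \<open>v > 0\<close> le by (simp add: power_diff)
    also have "v ^ (m - \<mu>) = (\<Sum>i\<le>m - \<mu>. real (m - \<mu> choose i) * (p * u) ^ i * q ^ (m - \<mu> - i))"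
      unfolding v add.commute[of q] by (rule binomial_ring)
    also have "\<dots> / u ^ m = (\<Sum>i\<le>m - \<mu>. mix_C \<kappa> \<mu> m i / (1 + mix_\<Omega> \<gamma> \<kappa> \<mu> m i * l) ^ mix_m \<mu> m i)"
      unfolding sum_divide_distrib
    proof (rule sum.cong[OF refl])
      fix i assume "i \<in> {..m - \<mu>}"
      then have "u ^ m = u ^ (m - i) * u ^ i" by (simp flip: power_add)
      then show "real (m - \<mu> choose i) * (p * u) ^ i * q ^ (m - \<mu> - i) / u ^ m
         = mix_C \<kappa> \<mu> m i / (1 + mix_\<Omega> \<gamma> \<kappa> \<mu> m i * l) ^ mix_m \<mu> m i"
        using False \<open>u > 0\<close>
        by (simp add: mix_C_def mix_\<Omega>_def mix_m_def p_def q_def power_mult_distrib flip: u_def)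
    qed
    finally show ?thesis using False by (simp only: L mix_M_def if_False atLeast0AtMost)
  qed
qed

text \<open>The substitution \<open>x / c\<close> normalises the denominator to
  \<open>(1 + x) ^ n\<close> and turns the rate into \<open>t = 1 / (c * w)\<close>. The Whittaker
  prefactors then cancel: the exponents of \<open>t\<close> add up to \<open>Suc k\<close>, and the
  exponentials to 1.\<close>

lemma integral_erlang_eq_whittaker:
  assumes "w > 0" "c > 0"
  shows "(\<integral>x. erlang_density k (1 / w) x / (1 + c * x) ^ n \<partial>lborel)
     = exp (1 / (2 * (c * w))) / (c * w) powr ((real (Suc k) + real n - 1) / 2)
       * whittaker_W (- ((real (Suc k) + real n - 1) / 2)) ((real (Suc k) - real n) / 2) (1 / (c * w))"
proof -
  define t where "t = 1 / (c * w)"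
  have t: "t > 0" using assms by (simp add: t_def)
  have "(\<integral>x. erlang_density k (1 / w) x / (1 + c * x) ^ n \<partial>lborel)
      = 1 / c * (\<integral>x. erlang_density k (1 / w) (x / c) / (1 + x) ^ n \<partial>lborel)"
    using lborel_integral_real_affine[of "1 / c" "\<lambda>x. erlang_density k (1 / w) x / (1 + c * x) ^ n" 0] assms
    by simp
  also have "\<dots> = (\<integral>x. 1 / c * (erlang_density k (1 / w) (x / c) / (1 + x) ^ n) \<partial>lborel)"
    by (simp only: integral_mult_right_zero)
  also have "\<dots> = (\<integral>x. erlang_density k t x / (1 + x) ^ n \<partial>lborel)"
  proof (rule Bochner_Integration.integral_cong[OF refl])
    fix x
    have "erlang_density k t x = 1 / c * erlang_density k (1 / w) (x / c)"
      using erlang_density_scale[of "1 / c" k "1 / w" x] assms by (simp add: t_def)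
    then show "1 / c * (erlang_density k (1 / w) (x / c) / (1 + x) ^ n) = erlang_density k t x / (1 + x) ^ n"
      by simp
  qed
  also have "\<dots> = t ^ Suc k * tricomi_U (real (Suc k)) (real k + 2 - real n) t"
    by (rule integral_erlang_over_power[OF t])
  also have "\<dots> = exp (t / 2) / (1 / t) powr ((real (Suc k) + real n - 1) / 2)
       * whittaker_W (- ((real (Suc k) + real n - 1) / 2)) ((real (Suc k) - real n) / 2) t"
  proof -
    have "(real (Suc k) - real n) / 2 - - ((real (Suc k) + real n - 1) / 2) + 1 / 2 = real (Suc k)"
      and "1 + 2 * ((real (Suc k) - real n) / 2) = real k + 2 - real n"
      by (simp_all add: field_simps)
    then have "whittaker_W (- ((real (Suc k) + real n - 1) / 2)) ((real (Suc k) - real n) / 2) t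
      = exp (- t / 2) * t powr ((real (Suc k) - real n) / 2 + 1 / 2) * tricomi_U (real (Suc k)) (real k + 2 - real n) t"
      by (simp only: whittaker_W_def)
    moreover have "t powr ((real (Suc k) - real n) / 2 + 1 / 2) / (1 / t) powr ((real (Suc k) + real n - 1) / 2) = t ^ Suc k"
    proof -
      have "x / (1 / t) powr e = x * t powr e" for x e :: real
        using t by (simp add: powr_divide)
      then have "t powr ((real (Suc k) - real n) / 2 + 1 / 2) / (1 / t) powr ((real (Suc k) + real n - 1) / 2)
        = t powr ((real (Suc k) - real n) / 2 + 1 / 2) * t powr ((real (Suc k) + real n - 1) / 2)"
        by (simp only:)
      also have "\<dots> = t powr (real (Suc k))"
        unfolding powr_add[symmetric] by (rule arg_cong[where f = "(powr) t"]) (simp add: field_simps)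
      also have "\<dots> = t ^ Suc k" using t by (rule powr_realpow)
      finally show ?thesis .
    qed
    moreover have "exp (t / 2) * exp (- t / 2) = 1" by (simp flip: exp_add)
    moreover have "x / b * (e * a * y) = (x * e) * (a / b) * y" for x b e a y :: real
      by (simp add: mult_ac)
    ultimately show ?thesis by (simp only: mult_1)
  qed
  finally show ?thesis by (simp add: t_def)
qed

text \<open>Linearity with coefficients of any sign. Each summand is integrable because
  \<open>f\<close> lives on the half-line, where the denominators are at least 1.\<close>

lemma integral_laplace_mixture:
  assumes f: "has_laplace f K" and "finite A" and "c \<ge> 0"
    and w: "\<And>i. i \<in> A \<Longrightarrow> w i \<ge> 0"
    and L: "\<And>l. l \<ge> 0 \<Longrightarrow> L l = (\<Sum>i\<in>A. C i / (1 + w i * l) ^ n i)"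
  shows "(\<integral>x. f x * L (c * x) \<partial>lborel) = (\<Sum>i\<in>A. C i * (\<integral>x. f x / (1 + w i * (c * x)) ^ n i \<partial>lborel))"
proof -
  note [measurable] = has_laplaceD(1)[OF f]
  have int: "integrable lborel (\<lambda>x. f x / (1 + w i * (c * x)) ^ n i)" if "i \<in> A" for i
  proof (rule Bochner_Integration.integrable_bound[OF has_laplace_integrable[OF f]])
    show "AE x in lborel. norm (f x / (1 + w i * (c * x)) ^ n i) \<le> norm (f x)"
    proof (rule AE_I2)
      fix x
      show "norm (f x / (1 + w i * (c * x)) ^ n i) \<le> norm (f x)"
      proof (cases "x < 0")
        case False
        then have "0 \<le> w i * (c * x)" using w[OF that] \<open>c \<ge> 0\<close> by simp
        then have "\<bar>f x\<bar> / (1 + w i * (c * x)) ^ n i \<le> \<bar>f x\<bar> / 1"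
          by (intro divide_left_mono) (auto intro!: zero_less_power)
        then show ?thesis using \<open>0 \<le> w i * (c * x)\<close> by (simp add: abs_divide power_abs)
      qed (simp add: has_laplaceD(4)[OF f])
    qed
  qed measurable
  have "f x * L (c * x) = (\<Sum>i\<in>A. C i * (f x / (1 + w i * (c * x)) ^ n i))" for x
  proof (cases "x < 0")
    case False
    then show ?thesis using \<open>c \<ge> 0\<close> L[of "c * x"] by (simp add: sum_distrib_left mult_ac)
  qed (simp add: has_laplaceD(4)[OF f])
  then have "(\<integral>x. f x * L (c * x) \<partial>lborel) = (\<integral>x. (\<Sum>i\<in>A. C i * (f x / (1 + w i * (c * x)) ^ n i)) \<partial>lborel)"
    by (simp only:)
  also have "\<dots> = (\<Sum>i\<in>A. \<integral>x. C i * (f x / (1 + w i * (c * x)) ^ n i) \<partial>lborel)"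
    by (intro Bochner_Integration.integral_sum integrable_mult_right int)
  finally show ?thesis by (simp only: integral_mult_right_zero)
qed

text \<open>Every component thus has the form \<open>Suc k\<close> required of an Erlang
  shape.\<close>

lemma mix_m_pos: "\<mu> \<ge> 1 \<Longrightarrow> i \<le> mix_M \<mu> m \<Longrightarrow> mix_m \<mu> m i \<ge> 1"
  by (auto simp: mix_m_def mix_M_def split: if_splits)

lemma mix_\<Omega>_pos:
  assumes "\<gamma> > 0" "\<kappa> \<ge> 0" "\<mu> \<ge> 1" "m \<ge> 1"
  shows "mix_\<Omega> \<gamma> \<kappa> \<mu> m i > 0"
  using mix_\<Delta>1_pos[OF assms(1-3)] mix_q_bounds[OF assms(2,4), of \<mu>]
  by (simp add: mix_\<Omega>_def mix_\<Delta>2_eq)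

text \<open>The shape parameters \<kappa> and \<kappa>' come last, as the variables of the later
  limit. Unlike the coefficients, this integral stays meaningful at 0.\<close>

definition product_mgf :: "real \<Rightarrow> real \<Rightarrow> nat \<Rightarrow> nat \<Rightarrow> nat \<Rightarrow> nat \<Rightarrow> real \<Rightarrow> real \<Rightarrow> real \<Rightarrow> real" where
  "product_mgf \<gamma> \<gamma>' j m j' m' s \<kappa> \<kappa>' =
     (\<integral>y. kms_law \<gamma>' \<kappa>' j' m' y * kms_laplace j m (mix_q \<kappa> (Suc j) m) (mix_\<Delta>1 \<gamma> \<kappa> (Suc j) * (- s * y)) \<partial>lborel)"

lemma product_mgf_eq_whittaker_sum:
  assumes "\<gamma> > 0" "\<gamma>' > 0" "\<kappa> \<ge> 0" "\<kappa>' \<ge> 0" "\<mu> \<ge> 1" "m \<ge> 1" "\<mu>' \<ge> 1" "m' \<ge> 1" "s < 0"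
    and "m < \<mu> \<longrightarrow> \<kappa> > 0" and "m' < \<mu>' \<longrightarrow> \<kappa>' > 0"
  shows "product_mgf \<gamma> \<gamma>' (\<mu> - 1) m (\<mu>' - 1) m' s \<kappa> \<kappa>' =
        (\<Sum>j = 0..mix_M \<mu> m. \<Sum>h = 0..mix_M \<mu>' m'.
          let C = mix_C \<kappa> \<mu> m j; C' = mix_C \<kappa>' \<mu>' m' h;
              n = real (mix_m \<mu> m j); n' = real (mix_m \<mu>' m' h);
              \<Omega> = mix_\<Omega> \<gamma> \<kappa> \<mu> m j; \<Omega>' = mix_\<Omega> \<gamma>' \<kappa>' \<mu>' m' h
          in C * C' * (exp (- (1 / (2 * s * \<Omega> * \<Omega>'))) / (- s * \<Omega> * \<Omega>') powr ((n + n' - 1) / 2))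
             * whittaker_W (- ((n + n' - 1) / 2)) ((n - n') / 2) (- (1 / (s * \<Omega> * \<Omega>'))))"
proof -
  have \<mu>: "Suc (\<mu> - 1) = \<mu>" "Suc (\<mu>' - 1) = \<mu>'" using assms by simp_all
  define g where "g = kms_law \<gamma>' \<kappa>' (\<mu>' - 1) m'"
  define K where "K l = kms_laplace (\<mu>' - 1) m' (mix_q \<kappa>' \<mu>' m') (mix_\<Delta>1 \<gamma>' \<kappa>' \<mu>' * l)" for l
  define L where "L l = kms_laplace (\<mu> - 1) m (mix_q \<kappa> \<mu> m) (mix_\<Delta>1 \<gamma> \<kappa> \<mu> * l)" for l
  have g: "has_laplace g K"
    unfolding g_def K_def[abs_def] using has_laplace_kms_law[of \<gamma>' \<kappa>' m' "\<mu>' - 1"] assms unfolding \<mu> by simp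
  have s: "- s \<ge> 0" using assms by simp
  have "product_mgf \<gamma> \<gamma>' (\<mu> - 1) m (\<mu>' - 1) m' s \<kappa> \<kappa>' = (\<integral>y. g y * L (- s * y) \<partial>lborel)"
    by (simp only: product_mgf_def g_def L_def \<mu>)
  also have "\<dots> = (\<Sum>j = 0..mix_M \<mu> m. mix_C \<kappa> \<mu> m j *
      (\<integral>y. g y / (1 + mix_\<Omega> \<gamma> \<kappa> \<mu> m j * (- s * y)) ^ mix_m \<mu> m j \<partial>lborel))"
    unfolding L_def using assms less_imp_le[OF mix_\<Omega>_pos]
    by (intro integral_laplace_mixture[OF g _ s] kms_laplace_mixture) auto
  also have "\<dots> = (\<Sum>j = 0..mix_M \<mu> m. \<Sum>h = 0..mix_M \<mu>' m'.
          let C = mix_C \<kappa> \<mu> m j; C' = mix_C \<kappa>' \<mu>' m' h;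
              n = real (mix_m \<mu> m j); n' = real (mix_m \<mu>' m' h);
              \<Omega> = mix_\<Omega> \<gamma> \<kappa> \<mu> m j; \<Omega>' = mix_\<Omega> \<gamma>' \<kappa>' \<mu>' m' h
          in C * C' * (exp (- (1 / (2 * s * \<Omega> * \<Omega>'))) / (- s * \<Omega> * \<Omega>') powr ((n + n' - 1) / 2))
             * whittaker_W (- ((n + n' - 1) / 2)) ((n - n') / 2) (- (1 / (s * \<Omega> * \<Omega>'))))"
  proof (rule sum.cong[OF refl])
    fix j assume "j \<in> {0..mix_M \<mu> m}"
    then have "mix_m \<mu> m j \<ge> 1" using assms by (intro mix_m_pos) auto
    then obtain k where k: "mix_m \<mu> m j = Suc k" by (cases "mix_m \<mu> m j") auto
    define w where "w = mix_\<Omega> \<gamma> \<kappa> \<mu> m j"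
    have w: "w > 0" unfolding w_def using assms by (intro mix_\<Omega>_pos)
    \<comment> \<open>The power is the transform of an Erlang density. The swap moves that density
      under the integral and brings \<open>g\<close> in through its transform \<open>K\<close>,
      which can be expanded in turn.\<close>
    have "(\<integral>y. g y / (1 + w * (- s * y)) ^ Suc k \<partial>lborel) = (\<integral>x. erlang_density k (1 / w) x * K (- s * x) \<partial>lborel)"
      using laplace_swap[OF has_laplace_erlang[OF w, of k] g s] by simp
    also have "\<dots> = (\<Sum>h = 0..mix_M \<mu>' m'. mix_C \<kappa>' \<mu>' m' h *
        (\<integral>x. erlang_density k (1 / w) x / (1 + mix_\<Omega> \<gamma>' \<kappa>' \<mu>' m' h * (- s * x)) ^ mix_m \<mu>' m' h \<partial>lborel))"
      unfolding K_def using assms less_imp_le[OF mix_\<Omega>_pos]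
      by (intro integral_laplace_mixture[OF has_laplace_erlang[OF w] _ s] kms_laplace_mixture) auto
    finally have eq: "(\<integral>y. g y / (1 + w * (- s * y)) ^ Suc k \<partial>lborel) = \<dots>" .
    show "mix_C \<kappa> \<mu> m j * (\<integral>y. g y / (1 + mix_\<Omega> \<gamma> \<kappa> \<mu> m j * (- s * y)) ^ mix_m \<mu> m j \<partial>lborel)
      = (\<Sum>h = 0..mix_M \<mu>' m'.
          let C = mix_C \<kappa> \<mu> m j; C' = mix_C \<kappa>' \<mu>' m' h;
              n = real (mix_m \<mu> m j); n' = real (mix_m \<mu>' m' h);
              \<Omega> = mix_\<Omega> \<gamma> \<kappa> \<mu> m j; \<Omega>' = mix_\<Omega> \<gamma>' \<kappa>' \<mu>' m' h
          in C * C' * (exp (- (1 / (2 * s * \<Omega> * \<Omega>'))) / (- s * \<Omega> * \<Omega>') powr ((n + n' - 1) / 2))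
             * whittaker_W (- ((n + n' - 1) / 2)) ((n - n') / 2) (- (1 / (s * \<Omega> * \<Omega>'))))"
      unfolding k w_def[symmetric] eq sum_distrib_left
    proof (rule sum.cong[OF refl])
      fix h
      define w' where "w' = mix_\<Omega> \<gamma>' \<kappa>' \<mu>' m' h"
      have w': "w' > 0" unfolding w'_def using assms by (intro mix_\<Omega>_pos)
      define c where "c = - s * w'"
      have c: "c > 0" using w' assms by (simp add: c_def mult_neg_pos)
      have e: "1 + w' * (- s * x) = 1 + c * x" for x by (simp add: c_def)
      have "- (1 / (2 * s * w * w')) = 1 / (2 * (c * w))" "- s * w * w' = c * w" "- (1 / (s * w * w')) = 1 / (c * w)"
        by (simp_all add: c_def mult_ac)
      then show "mix_C \<kappa> \<mu> m j * (mix_C \<kappa>' \<mu>' m' h *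
           (\<integral>x. erlang_density k (1 / w) x / (1 + mix_\<Omega> \<gamma>' \<kappa>' \<mu>' m' h * (- s * x)) ^ mix_m \<mu>' m' h \<partial>lborel))
        = (let C = mix_C \<kappa> \<mu> m j; C' = mix_C \<kappa>' \<mu>' m' h;
              n = real (Suc k); n' = real (mix_m \<mu>' m' h);
              \<Omega> = w; \<Omega>' = mix_\<Omega> \<gamma>' \<kappa>' \<mu>' m' h
          in C * C' * (exp (- (1 / (2 * s * \<Omega> * \<Omega>'))) / (- s * \<Omega> * \<Omega>') powr ((n + n' - 1) / 2))
             * whittaker_W (- ((n + n' - 1) / 2)) ((n - n') / 2) (- (1 / (s * \<Omega> * \<Omega>'))))"
        unfolding Let_def w'_def[symmetric] e integral_erlang_eq_whittaker[OF w c]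
        by (simp only: mult.assoc)
    qed
  qed
  finally show ?thesis .
qed

section \<open>Continuity in the shape parameters\<close>

lemma product_mgf_scaled:
  assumes "\<gamma>' > 0" "\<kappa>' \<ge> 0"
  shows "product_mgf \<gamma> \<gamma>' j m j' m' s \<kappa> \<kappa>' =
     (\<integral>y. unit_kms_density j' m' (mix_q \<kappa>' (Suc j') m') y *
        kms_laplace j m (mix_q \<kappa> (Suc j) m) (- s * mix_\<Delta>1 \<gamma> \<kappa> (Suc j) * mix_\<Delta>1 \<gamma>' \<kappa>' (Suc j') * y) \<partial>lborel)"
proof -
  \<comment> \<open>Substituting by this scale collects both scales in the argument of the
    transform; the density then depends on \<kappa>' only through \<open>q\<close>, the parameter
    for which a dominating function exists.\<close>
  define d where "d = mix_\<Delta>1 \<gamma>' \<kappa>' (Suc j')"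
  have d: "d > 0" unfolding d_def using assms by (intro mix_\<Delta>1_pos) auto
  show ?thesis
    unfolding product_mgf_def kms_law_def d_def[symmetric]
    using lborel_integral_real_affine[of d "\<lambda>y. unit_kms_density j' m' (mix_q \<kappa>' (Suc j') m') (y / d) / d *
        kms_laplace j m (mix_q \<kappa> (Suc j) m) (mix_\<Delta>1 \<gamma> \<kappa> (Suc j) * (- s * y))" 0] d
    by (simp add: mult_ac)
qed

text \<open>Since \<open>l \<le> l / (1 - q)\<close>, the quotient is at most
  \<open>1 / (1 + l) ^ Suc k\<close>.\<close>

lemma kms_laplace_bounds:
  assumes "0 \<le> q" "q < 1" "0 \<le> l"
  shows "0 \<le> kms_laplace k m q l" "kms_laplace k m q l \<le> 1"
proof -
  show "0 \<le> kms_laplace k m q l" using assms by (simp add: kms_laplace_def)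
  have "l * (1 - q) \<le> l" using assms by (simp add: mult_left_le)
  then have "l \<le> l / (1 - q)" using assms by (simp add: le_divide_eq)
  then have "(1 + l) ^ m \<le> (1 + l / (1 - q)) ^ m" using assms by (intro power_mono) auto
  moreover have "1 \<le> (1 + l) ^ Suc k" using assms by (intro one_le_power) simp
  moreover have "0 < (1 + l / (1 - q)) ^ m" using assms by (intro zero_less_power add_pos_nonneg) auto
  ultimately have "1 * (1 + l) ^ m \<le> (1 + l) ^ Suc k * (1 + l / (1 - q)) ^ m"
    using assms by (intro mult_mono) auto
  then show "kms_laplace k m q l \<le> 1"
    unfolding kms_laplace_def using \<open>0 < (1 + l / (1 - q)) ^ m\<close> \<open>1 \<le> (1 + l) ^ Suc k\<close> assms
    by (subst divide_le_eq_1_pos) auto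
qed

text \<open>The \<open>\<^sub>1F\<^sub>1\<close> factor increases with \<open>q\<close>, so near any \<open>q < 1\<close> the densities are dominated by a
  multiple of a single one.\<close>

lemma unit_kms_density_le:
  assumes "0 \<le> q" "q \<le> Q" "Q < 1"
  shows "unit_kms_density k m q u \<le> unit_kms_density k m Q u / (1 - Q) ^ m"
proof (cases "u < 0")
  case False
  then have "kummer_1F1 (real m) (real (Suc k)) (q * u) \<le> kummer_1F1 (real m) (real (Suc k)) (Q * u)"
    and "0 \<le> kummer_1F1 (real m) (real (Suc k)) (q * u)"
    using assms kummer_1F1_mono[of "real m" "real (Suc k)" "q * u" "Q * u"] by (simp_all add: mult_right_mono)
  moreover have "(1 - q) ^ m \<le> 1" using assms by (intro power_le_one) auto
  ultimately have "(1 - q) ^ m * (erlang_density k 1 u * kummer_1F1 (real m) (real (Suc k)) (q * u))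
     \<le> 1 * (erlang_density k 1 u * kummer_1F1 (real m) (real (Suc k)) (Q * u))"
    by (intro mult_mono mult_left_mono) auto
  then show ?thesis using assms by (simp add: unit_kms_density_def mult.assoc)
qed (simp add: unit_kms_density_def erlang_density_def)

lemma product_mgf_tendsto:
  assumes "\<gamma> > 0" "\<gamma>' > 0" "\<kappa> \<ge> 0" "\<kappa>' \<ge> 0" "m \<ge> 1" "m' \<ge> 1" "s < 0"
    and S: "S \<subseteq> {0..} \<times> {0..}"
  shows "((\<lambda>(k, k'). product_mgf \<gamma> \<gamma>' j m j' m' s k k') \<longlongrightarrow> product_mgf \<gamma> \<gamma>' j m j' m' s \<kappa> \<kappa>') (at (\<kappa>, \<kappa>') within S)"
  unfolding tendsto_at_iff_sequentially comp_def
proof (intro allI impI)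
  fix Z :: "nat \<Rightarrow> real \<times> real"
  assume "\<forall>i. Z i \<in> S - {(\<kappa>, \<kappa>')}" and Z: "Z \<longlonglongrightarrow> (\<kappa>, \<kappa>')"
  then have "Z i \<in> {0..} \<times> {0..}" for i using S by blast
  then have pos: "fst (Z i) \<ge> 0" "snd (Z i) \<ge> 0" for i by (auto simp: mem_Times_iff)
  define q where "q i = mix_q (fst (Z i)) (Suc j) m" for i
  define q' where "q' i = mix_q (snd (Z i)) (Suc j') m'" for i
  define d where "d i = - s * mix_\<Delta>1 \<gamma> (fst (Z i)) (Suc j) * mix_\<Delta>1 \<gamma>' (snd (Z i)) (Suc j')" for i
  define q0 where "q0 = mix_q \<kappa> (Suc j) m"
  define q0' where "q0' = mix_q \<kappa>' (Suc j') m'"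
  define d0 where "d0 = - s * mix_\<Delta>1 \<gamma> \<kappa> (Suc j) * mix_\<Delta>1 \<gamma>' \<kappa>' (Suc j')"
  have ZZ: "(\<lambda>i. fst (Z i)) \<longlonglongrightarrow> \<kappa>" "(\<lambda>i. snd (Z i)) \<longlonglongrightarrow> \<kappa>'"
    using tendsto_fst[OF Z] tendsto_snd[OF Z] by simp_all
  have ne: "real n * \<kappa> + real m \<noteq> 0" if "\<kappa> \<ge> 0" "m \<ge> 1" for n m and \<kappa> :: real
    using that by (intro less_imp_neq[symmetric] add_nonneg_pos) auto
  have q: "q \<longlonglongrightarrow> q0" unfolding q_def q0_def mix_q_def using assms ne by (intro tendsto_intros ZZ) (auto simp del: of_nat_Suc)
  have q': "q' \<longlonglongrightarrow> q0'" unfolding q'_def q0'_def mix_q_def using assms ne by (intro tendsto_intros ZZ) (auto simp del: of_nat_Suc)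
  have d: "d \<longlonglongrightarrow> d0" unfolding d_def d0_def mix_\<Delta>1_def using assms by (intro tendsto_intros ZZ) auto
  have q_bounds: "0 \<le> q i" "q i < 1" and q'_bounds: "0 \<le> q' i" "q' i < 1" for i
    unfolding q_def q'_def using mix_q_bounds assms pos by simp_all
  have q0_bounds: "0 \<le> q0" "q0 < 1" "0 \<le> q0'" "q0' < 1"
    unfolding q0_def q0'_def using mix_q_bounds assms by simp_all
  have d_pos: "d i \<ge> 0" for i
    unfolding d_def using assms pos mix_\<Delta>1_pos[of \<gamma> "fst (Z i)" "Suc j"] mix_\<Delta>1_pos[of \<gamma>' "snd (Z i)" "Suc j'"]
    by (intro mult_nonneg_nonneg) auto
  have d0_pos: "d0 \<ge> 0"
    unfolding d0_def using assms mix_\<Delta>1_pos[of \<gamma> \<kappa> "Suc j"] mix_\<Delta>1_pos[of \<gamma>' \<kappa>' "Suc j'"]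
    by (intro mult_nonneg_nonneg) auto
  \<comment> \<open>Any \<open>Q\<close> strictly between the limit \<open>q0'\<close> and 1
    eventually exceeds all \<open>q' i\<close>; the density at \<open>Q\<close>, up to a constant,
    then dominates, the transform factor being at most 1.\<close>
  obtain Q where Q: "q0' < Q" "Q < 1" using q0_bounds dense by blast
  obtain N where N: "\<And>i. i \<ge> N \<Longrightarrow> q' i < Q"
    using order_tendstoD(2)[OF q' Q(1)] by (auto simp: eventually_sequentially)
  have "(\<lambda>i. \<integral>y. unit_kms_density j' m' (q' (i + N)) y * kms_laplace j m (q (i + N)) (d (i + N) * y) \<partial>lborel)
      \<longlonglongrightarrow> (\<integral>y. unit_kms_density j' m' q0' y * kms_laplace j m q0 (d0 * y) \<partial>lborel)"
  proof (rule integral_dominated_convergence[where w = "\<lambda>y. unit_kms_density j' m' Q y / (1 - Q) ^ m'"])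
    have [measurable]: "kms_laplace j m q \<in> borel_measurable borel" for q
      unfolding kms_laplace_def[abs_def] by measurable
    show "(\<lambda>y. unit_kms_density j' m' q0' y * kms_laplace j m q0 (d0 * y)) \<in> borel_measurable lborel"
      "(\<lambda>y. unit_kms_density j' m' (q' (i + N)) y * kms_laplace j m (q (i + N)) (d (i + N) * y)) \<in> borel_measurable lborel" for i
      by measurable
    have "has_laplace (unit_kms_density j' m' Q) (kms_laplace j' m' Q)"
      using Q q0_bounds by (intro has_laplace_unit_kms_density) auto
    from has_laplace_integrable[OF this]
    show "integrable lborel (\<lambda>y. unit_kms_density j' m' Q y / (1 - Q) ^ m')" by simp
    show "AE y in lborel. norm (unit_kms_density j' m' (q' (i + N)) y * kms_laplace j m (q (i + N)) (d (i + N) * y))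
        \<le> unit_kms_density j' m' Q y / (1 - Q) ^ m'" for i
    proof (rule AE_I2)
      fix y
      show "norm (unit_kms_density j' m' (q' (i + N)) y * kms_laplace j m (q (i + N)) (d (i + N) * y))
        \<le> unit_kms_density j' m' Q y / (1 - Q) ^ m'"
      proof (cases "y < 0")
        case False
        then have "0 \<le> d (i + N) * y" using d_pos by simp
        note L = kms_laplace_bounds[OF q_bounds this, where k = j and m = m]
        note f = unit_kms_density_nonneg[OF q'_bounds, of j' m' "i + N" y]
        have "norm (unit_kms_density j' m' (q' (i + N)) y * kms_laplace j m (q (i + N)) (d (i + N) * y))
          = unit_kms_density j' m' (q' (i + N)) y * kms_laplace j m (q (i + N)) (d (i + N) * y)"
          using L(1) f by simp
        also have "\<dots> \<le> unit_kms_density j' m' (q' (i + N)) y * 1"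
          by (intro mult_left_mono L(2) f)
        also have "\<dots> \<le> unit_kms_density j' m' Q y / (1 - Q) ^ m'"
          using unit_kms_density_le[OF q'_bounds(1)] N[of "i + N"] Q by (simp add: less_imp_le)
        finally show ?thesis .
      qed (simp add: unit_kms_density_def erlang_density_def)
    qed
    show "AE y in lborel. (\<lambda>i. unit_kms_density j' m' (q' (i + N)) y * kms_laplace j m (q (i + N)) (d (i + N) * y))
        \<longlonglongrightarrow> unit_kms_density j' m' q0' y * kms_laplace j m q0 (d0 * y)"
    proof (rule AE_I2)
      fix y
      show "(\<lambda>i. unit_kms_density j' m' (q' (i + N)) y * kms_laplace j m (q (i + N)) (d (i + N) * y))
        \<longlonglongrightarrow> unit_kms_density j' m' q0' y * kms_laplace j m q0 (d0 * y)"
      proof (cases "y < 0")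
        case False
        have "0 \<le> d0 * y" using False d0_pos by simp
        then have "1 + d0 * y \<noteq> 0" "1 + d0 * y / (1 - q0) \<noteq> 0" "1 - q0 \<noteq> 0"
          using q0_bounds by (auto simp: add_nonneg_eq_0_iff)
        have "(\<lambda>i. kummer_1F1 (real m') (real (Suc j')) (q' i * y)) \<longlonglongrightarrow> kummer_1F1 (real m') (real (Suc j')) (q0' * y)"
          by (rule isCont_tendsto_compose[OF isCont_kummer_1F1]) (auto intro!: tendsto_intros q')
        then have "(\<lambda>i. unit_kms_density j' m' (q' i) y * kms_laplace j m (q i) (d i * y))
          \<longlonglongrightarrow> unit_kms_density j' m' q0' y * kms_laplace j m q0 (d0 * y)"
          unfolding unit_kms_density_def kms_laplace_def
          using \<open>1 + d0 * y \<noteq> 0\<close> \<open>1 + d0 * y / (1 - q0) \<noteq> 0\<close> \<open>1 - q0 \<noteq> 0\<close>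
          by (intro tendsto_intros q q' d) auto
        then show ?thesis by (rule LIMSEQ_ignore_initial_segment)
      qed (simp add: unit_kms_density_def erlang_density_def)
    qed
  qed
  then have "(\<lambda>i. \<integral>y. unit_kms_density j' m' (q' i) y * kms_laplace j m (q i) (d i * y) \<partial>lborel)
      \<longlonglongrightarrow> (\<integral>y. unit_kms_density j' m' q0' y * kms_laplace j m q0 (d0 * y) \<partial>lborel)"
    by (rule LIMSEQ_offset)
  then show "(\<lambda>i. case Z i of (k, k') \<Rightarrow> product_mgf \<gamma> \<gamma>' j m j' m' s k k') \<longlonglongrightarrow> product_mgf \<gamma> \<gamma>' j m j' m' s \<kappa> \<kappa>'"
    using assms pos
    by (simp add: product_mgf_scaled case_prod_beta q_def q'_def d_def q0_def q0'_def d0_def)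
qed

text \<open>For \<kappa> = 0 and \<open>m < \<mu>\<close> the coefficients contain negative powers
  of \<open>q = 0\<close>; the second conjunct gives the formula its meaning there, as a limit that
  never consults \<open>F\<close> at the point itself. The sign of \<open>s\<close> makes the
  Whittaker arguments positive.\<close>

theorem proposition3:
  fixes P :: "'a measure"
    and X X' :: "'a \<Rightarrow> real"
    and \<gamma> \<gamma>' \<kappa> \<kappa>' s :: real
    and \<mu> m \<mu>' m' :: nat
  assumes "prob_space P"
    and "\<gamma> > 0" and "\<gamma>' > 0"
    and "\<kappa> \<ge> 0" and "\<kappa>' \<ge> 0"
    and "\<mu> \<ge> 1" and "m \<ge> 1" and "\<mu>' \<ge> 1" and "m' \<ge> 1"
    and "squared_kappa_mu_shadowed P X \<gamma> \<kappa> (real \<mu>) (real m)"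
    and "squared_kappa_mu_shadowed P X' \<gamma>' \<kappa>' (real \<mu>') (real m')"
    and "prob_space.indep_var P borel X borel X'"
    and "s < 0"
  shows
    "let F = (\<lambda>k k'.
        \<Sum>j = 0..mix_M \<mu> m. \<Sum>h = 0..mix_M \<mu>' m'.
          let C = mix_C k \<mu> m j; C' = mix_C k' \<mu>' m' h;
              n = real (mix_m \<mu> m j); n' = real (mix_m \<mu>' m' h);
              \<Omega> = mix_\<Omega> \<gamma> k \<mu> m j; \<Omega>' = mix_\<Omega> \<gamma>' k' \<mu>' m' h
          in C * C' * (exp (- (1 / (2 * s * \<Omega> * \<Omega>'))) / (- s * \<Omega> * \<Omega>') powr ((n + n' - 1) / 2))
             * whittaker_W (- ((n + n' - 1) / 2)) ((n - n') / 2) (- (1 / (s * \<Omega> * \<Omega>'))))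
     in ((m < \<mu> \<longrightarrow> \<kappa> > 0) \<and> (m' < \<mu>' \<longrightarrow> \<kappa>' > 0) \<longrightarrow>
           mgf P (\<lambda>\<omega>. X \<omega> * X' \<omega>) s = F \<kappa> \<kappa>')
        \<and> ((\<lambda>(k, k'). F k k') \<longlongrightarrow> mgf P (\<lambda>\<omega>. X \<omega> * X' \<omega>) s)
            (at (\<kappa>, \<kappa>') within {k. k \<ge> 0 \<and> (m < \<mu> \<longrightarrow> k > 0)} \<times> {k. k \<ge> 0 \<and> (m' < \<mu>' \<longrightarrow> k > 0)})"
    (is "let F = ?F in ?goal F")
proof -
  define F where "F = ?F"
  define S where "S = {k::real. k \<ge> 0 \<and> (m < \<mu> \<longrightarrow> k > 0)} \<times> {k::real. k \<ge> 0 \<and> (m' < \<mu>' \<longrightarrow> k > 0)}"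
  define G where "G = product_mgf \<gamma> \<gamma>' (\<mu> - 1) m (\<mu>' - 1) m' s"
  have \<mu>: "Suc (\<mu> - 1) = \<mu>" "Suc (\<mu>' - 1) = \<mu>'" using assms by simp_all
  \<comment> \<open>Within the nonnegative quadrant, \<open>S\<close> omits exactly the parameters
    with negative powers of \<open>q = 0\<close>. \<open>G\<close> is continuous there too, so its
    value is the limit of \<open>F\<close> along \<open>S\<close>.\<close>
  have GF: "G k k' = F k k'" if "(k, k') \<in> S" for k k'
    unfolding G_def F_def using that assms by (intro product_mgf_eq_whittaker_sum) (auto simp: S_def)
  have X: "distributed P lborel X (\<lambda>x. ennreal (kms_density \<gamma> \<kappa> (real \<mu>) (real m) x))"
    and X': "distributed P lborel X' (\<lambda>x. ennreal (kms_density \<gamma>' \<kappa>' (real \<mu>') (real m') x))"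
    using assms by (simp_all add: squared_kappa_mu_shadowed_def)
  have mgf: "mgf P (\<lambda>\<omega>. X \<omega> * X' \<omega>) s = G \<kappa> \<kappa>'"
    unfolding G_def product_mgf_def
  proof (rule mgf_product_eq_laplace[OF assms(1) assms(12) X X' _ _ _ _ assms(13)])
    show "has_laplace (kms_law \<gamma> \<kappa> (\<mu> - 1) m)
       (\<lambda>l. kms_laplace (\<mu> - 1) m (mix_q \<kappa> (Suc (\<mu> - 1)) m) (mix_\<Delta>1 \<gamma> \<kappa> (Suc (\<mu> - 1)) * l))"
      "has_laplace (kms_law \<gamma>' \<kappa>' (\<mu>' - 1) m')
       (\<lambda>l. kms_laplace (\<mu>' - 1) m' (mix_q \<kappa>' (Suc (\<mu>' - 1)) m') (mix_\<Delta>1 \<gamma>' \<kappa>' (Suc (\<mu>' - 1)) * l))"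
      using assms by (intro has_laplace_kms_law; simp)+
    show "kms_density \<gamma> \<kappa> (real \<mu>) (real m) x = kms_law \<gamma> \<kappa> (\<mu> - 1) m x" if "x \<noteq> 0" for x
      using kms_density_eq_unit[of \<gamma> \<kappa> m x "\<mu> - 1"] that assms unfolding \<mu> by (simp add: kms_law_def \<mu>)
    show "kms_density \<gamma>' \<kappa>' (real \<mu>') (real m') x = kms_law \<gamma>' \<kappa>' (\<mu>' - 1) m' x" if "x \<noteq> 0" for x
      using kms_density_eq_unit[of \<gamma>' \<kappa>' m' x "\<mu>' - 1"] that assms unfolding \<mu> by (simp add: kms_law_def \<mu>)
  qed
  have "((\<lambda>(k, k'). G k k') \<longlongrightarrow> G \<kappa> \<kappa>') (at (\<kappa>, \<kappa>') within S)"
    unfolding G_def using assms by (intro product_mgf_tendsto) (auto simp: S_def)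
  moreover have "\<forall>\<^sub>F z in at (\<kappa>, \<kappa>') within S. (case z of (k, k') \<Rightarrow> G k k') = (case z of (k, k') \<Rightarrow> F k k')"
    unfolding eventually_at_filter using GF by (intro always_eventually) auto
  ultimately have "((\<lambda>(k, k'). F k k') \<longlongrightarrow> G \<kappa> \<kappa>') (at (\<kappa>, \<kappa>') within S)"
    by (rule Lim_transform_eventually)
  moreover have "G \<kappa> \<kappa>' = F \<kappa> \<kappa>'" if "(m < \<mu> \<longrightarrow> \<kappa> > 0) \<and> (m' < \<mu>' \<longrightarrow> \<kappa>' > 0)"
    using that assms by (intro GF) (simp add: S_def)
  ultimately have "?goal F" unfolding mgf S_def by blast
  then show ?thesis unfolding Let_def F_def .
qed

end
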